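(* The geometries $\Gamma_\mathbb{R}(\mathbb{H})$ and $\Gamma_\mathbb{C}(\mathbb{O})$ (the geometric supports of the two $\mathbb{O}\mathrm{P}^2$-geometries) are simply connected.
   Context: $\mathbb{H}$, $\mathbb{O}$ are the real quaternions and octonions, $\mathbb{C}\subset\mathbb{H}\subset\mathbb{O}$. For $(\mathbb{F},\mathbb{A})\in\{(\mathbb{R},\mathbb{H}),(\mathbb{C},\mathbb{O})\}$, $\mathbb{A},\mathbb{O}$ are right $\mathbb{F}$-vector spaces via right multiplication by $\mathbb{F}$. $(x|y)_\mathbb{R}=\mathrm{Re}(\bar xy)$; $(x|y)=(x|y)_\mathbb{R}$ if $\mathbb{F}=\mathbb{R}$, and for $\mathbb{F}=\mathbb{C}$, $(x|y)$ is the $\mathbb{C}$-component of $\bar xy$ in $\mathbb{O}=\mathbb{C}\oplus\mathbb{C}^{\perp}$. $\mathrm{Pu}_\mathbb{F}(\mathbb{B})$ is the real-orthogonal complement of $\mathbb{F}$ in $\mathbb{B}$. Sharp $\mathbb{F}$-morphisms $\mathbb{A}\to\mathbb{O}$: $\mathbb{F}$-linear multiplicative maps preserving $(\cdot|\cdot)$. $\Gamma_\mathbb{F}(\mathbb{A})$: points are 1-dim $\mathbb{F}$-subspaces $[x]$ of $\mathrm{Pu}_\mathbb{F}(\mathbb{A})$; lines are $[x,u]=\{(xt,ut):t\in\mathbb{F}^*\}$ with $x\in\mathrm{Pu}_\mathbb{F}(\mathbb{A})$, $u\in\mathrm{Pu}_\mathbb{F}(\mathbb{O})$, $|x|=|u|\ne0$;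 planes are sharp $\mathbb{F}$-morphisms $\phi:\mathbb{A}\to\mathbb{O}$; every point is incident with every plane, $[y]$ is incident with $[x,u]$ iff $(x|y)=0$, $[x,u]$ is incident with $\phi$ iff $\phi(x)=u$. It is a flat geometry of type $C_3$. A rank-3 geometry is simply connected if it admits no proper covering (covering = type-preserving morphism inducing isomorphisms on rank-2 residues), equivalently its flag complex has trivial fundamental group. *)

theory Defs
  imports Complex_Main
begin

section \<open>Quaternions and octonions via Cayley-Dickson doubling\<close>

type_synonym quat = "complex \<times> complex"
type_synonym oct = "quat \<times> quat"

definition qadd :: "quat \<Rightarrow> quat \<Rightarrow> quat" where
  "qadd p q = (fst p + fst q, snd p + snd q)"
definition qneg :: "quat \<Rightarrow> quat" where
  "qneg p = (- fst p, - snd p)"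
definition qcnj :: "quat \<Rightarrow> quat" where
  "qcnj p = (cnj (fst p), - snd p)"
definition qmul :: "quat \<Rightarrow> quat \<Rightarrow> quat" where
  "qmul p q = (fst p * fst q - cnj (snd q) * snd p, snd q * fst p + snd p * cnj (fst q))"

definition ozero :: oct where "ozero = ((0,0),(0,0))"
definition oadd :: "oct \<Rightarrow> oct \<Rightarrow> oct" where
  "oadd x y = (qadd (fst x) (fst y), qadd (snd x) (snd y))"
definition ocnj :: "oct \<Rightarrow> oct" where
  "ocnj x = (qcnj (fst x), qneg (snd x))"
definition omul :: "oct \<Rightarrow> oct \<Rightarrow> oct" where
  "omul x y = (qadd (qmul (fst x) (fst y)) (qneg (qmul (qcnj (snd y)) (snd x))),
               qadd (qmul (snd y) (fst x)) (qmul (snd x) (qcnj (fst y))))"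

definition ofC :: "complex \<Rightarrow> oct" where "ofC z = ((z,0),(0,0))"
definition ofR :: "real \<Rightarrow> oct" where "ofR r = ofC (complex_of_real r)"
definition ofH :: "quat \<Rightarrow> oct" where "ofH q = (q,(0,0))"

definition Rset :: "oct set" where "Rset = range ofR"
definition Cset :: "oct set" where "Cset = range ofC"
definition Hset :: "oct set" where "Hset = range ofH"
definition Oset :: "oct set" where "Oset = UNIV"

definition ore :: "oct \<Rightarrow> real" where "ore x = Re (fst (fst x))"
definition ipR :: "oct \<Rightarrow> oct \<Rightarrow> real" where "ipR x y = ore (omul (ocnj x) y)"
definition onorm2 :: "oct \<Rightarrow> real" where "onorm2 x = ipR x x"

text \<open>The F-valued form (x|y), embedded in O: for F = R the real part of conj x * y,
  for F = C the C-component of conj x * y in O = C \<oplus> C^\<perp>.\<close>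
definition pairR :: "oct \<Rightarrow> oct \<Rightarrow> oct" where "pairR x y = ofR (ipR x y)"
definition pairC :: "oct \<Rightarrow> oct \<Rightarrow> oct" where
  "pairC x y = ofC (fst (fst (omul (ocnj x) y)))"

definition Pu :: "oct set \<Rightarrow> oct set \<Rightarrow> oct set" where
  "Pu F B = {x \<in> B. \<forall>t\<in>F. ipR t x = 0}"

definition opoint :: "oct set \<Rightarrow> oct \<Rightarrow> oct set" where
  "opoint F x = {omul x t | t. t \<in> F}"
definition oline :: "oct set \<Rightarrow> oct \<Rightarrow> oct \<Rightarrow> (oct \<times> oct) set" where
  "oline F x u = {(omul x t, omul u t) | t. t \<in> F \<and> t \<noteq> ozero}"

text \<open>Sharp F-morphisms A \<rightarrow> O, represented as functions vanishing outside A.\<close>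
definition sharp :: "oct set \<Rightarrow> oct set \<Rightarrow> (oct \<Rightarrow> oct \<Rightarrow> oct) \<Rightarrow> (oct \<Rightarrow> oct) \<Rightarrow> bool" where
  "sharp F A pr \<phi> \<longleftrightarrow>
     (\<forall>x. x \<notin> A \<longrightarrow> \<phi> x = ozero) \<and>
     (\<forall>x\<in>A. \<forall>y\<in>A. \<phi> (oadd x y) = oadd (\<phi> x) (\<phi> y)) \<and>
     (\<forall>x\<in>A. \<forall>t\<in>F. \<phi> (omul x t) = omul (\<phi> x) t) \<and>
     (\<forall>x\<in>A. \<forall>y\<in>A. \<phi> (omul x y) = omul (\<phi> x) (\<phi> y)) \<and>
     (\<forall>x\<in>A. \<forall>y\<in>A. pr (\<phi> x) (\<phi> y) = pr x y)"

datatype elem = Pt "oct set" | Ln "(oct \<times> oct) set" | Pl "oct \<Rightarrow> oct"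

definition Gelems :: "oct set \<Rightarrow> oct set \<Rightarrow> (oct \<Rightarrow> oct \<Rightarrow> oct) \<Rightarrow> elem set" where
  "Gelems F A pr =
     {Pt (opoint F x) | x. x \<in> Pu F A \<and> x \<noteq> ozero} \<union>
     {Ln (oline F x u) | x u. x \<in> Pu F A \<and> u \<in> Pu F Oset \<and> onorm2 x = onorm2 u \<and> onorm2 x \<noteq> 0} \<union>
     {Pl \<phi> | \<phi>. sharp F A pr \<phi>}"

fun incid0 :: "oct set \<Rightarrow> (oct \<Rightarrow> oct \<Rightarrow> oct) \<Rightarrow> elem \<Rightarrow> elem \<Rightarrow> bool" where
  "incid0 F pr (Pt P) (Pl \<phi>) = True"
| "incid0 F pr (Pt P) (Ln L) = (\<exists>x u y. L = oline F x u \<and> P = opoint F y \<and> pr x y = ozero)"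
| "incid0 F pr (Ln L) (Pl \<phi>) = (\<exists>x u. L = oline F x u \<and> \<phi> x = u)"
| "incid0 F pr a b = False"

definition Gincid :: "oct set \<Rightarrow> (oct \<Rightarrow> oct \<Rightarrow> oct) \<Rightarrow> elem \<Rightarrow> elem \<Rightarrow> bool" where
  "Gincid F pr a b \<longleftrightarrow> a = b \<or> incid0 F pr a b \<or> incid0 F pr b a"

section \<open>Simple connectivity (trivial fundamental group of the flag complex)\<close>

definition is_path :: "'e set \<Rightarrow> ('e \<Rightarrow> 'e \<Rightarrow> bool) \<Rightarrow> 'e list \<Rightarrow> bool" where
  "is_path V I p \<longleftrightarrow> p \<noteq> [] \<and> set p \<subseteq> V \<and> (\<forall>i. Suc i < length p \<longrightarrow> I (p ! i) (p ! Suc i))"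

text \<open>Elementary homotopies of edge paths in the flag complex: removing a stutter,
  and shortcutting across a 2-simplex (three pairwise incident elements).\<close>
definition elem_move :: "('e \<Rightarrow> 'e \<Rightarrow> bool) \<Rightarrow> 'e list \<Rightarrow> 'e list \<Rightarrow> bool" where
  "elem_move I p q \<longleftrightarrow>
     (\<exists>xs a b c ys. p = xs @ [a,b,c] @ ys \<and> q = xs @ [a,c] @ ys \<and> I a b \<and> I b c \<and> I a c) \<or>
     (\<exists>xs a ys. p = xs @ [a,a] @ ys \<and> q = xs @ [a] @ ys)"

definition homotopic :: "'e set \<Rightarrow> ('e \<Rightarrow> 'e \<Rightarrow> bool) \<Rightarrow> 'e list \<Rightarrow> 'e list \<Rightarrow> bool" where
  "homotopic V I = (\<lambda>p q. is_path V I p \<and> is_path V I q \<and> (elem_move I p q \<or> elem_move I q p))\<^sup>*\<^sup>*"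

definition simply_connected :: "'e set \<Rightarrow> ('e \<Rightarrow> 'e \<Rightarrow> bool) \<Rightarrow> bool" where
  "simply_connected V I \<longleftrightarrow>
     (\<forall>a\<in>V. \<forall>b\<in>V. \<exists>p. is_path V I p \<and> hd p = a \<and> last p = b) \<and>
     (\<forall>p. is_path V I p \<and> hd p = last p \<longrightarrow> homotopic V I p [hd p])"

end

theory Submission
  imports Defs "HOL-Analysis.Linear_Algebra"
begin

text \<open>In a flat geometry every path can be pushed into the complete bipartite graph of points and planes, so
  it suffices to contract the squares \<open>p, s, q, t\<close>. If \<open>s\<close> and \<open>t\<close> agree at some \<open>z\<close> orthogonal
  to \<open>p\<close> and \<open>q\<close>, the four elements lie on the common line \<open>[z, s z]\<close>, and the square is null.
  For an orthonormal frame \<open>x, y, xy\<close> of \<open>Pu A\<close> the class of the loop through \<open>xy\<close>, \<open>s'\<close>, \<open>y\<close>, \<open>s\<close>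
  therefore depends only on \<open>s' x\<close> and \<open>s x\<close>. Comparing it with the loop through the point
  \<open>x - y\<close>, for which \<open>x + y\<close> plays the role of \<open>x\<close>, shows that the loops with values \<open>(u', u)\<close> and
  \<open>(v', v)\<close> are homotopic whenever \<open>u v = u' v'\<close>. Going around a frame of \<open>\<complex>\<^sup>3\<close> in three such steps
  replaces a phase by its conjugate, so a change of \<open>s x\<close> by a phase is invisible; in a frame rotated by
  45 degrees this shows that replacing \<open>s x\<close> by an orthogonal vector is invisible as well, and any two
  vectors have a common orthogonal one. Planes with prescribed values come from automorphisms of the
  octonions, built by applying the Cayley--Dickson construction twice inside \<open>\<O>\<close>.\<close>

section \<open>Homotopy of edge paths\<close>

lemma is_path_successively:
  "is_path V I p \<longleftrightarrow> p \<noteq> [] \<and> set p \<subseteq> V \<and> successively I p"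
  by (auto simp: is_path_def successively_conv_nth)

lemma elem_move_append:
  assumes "elem_move I p q"
  shows "elem_move I (xs @ p @ ys) (xs @ q @ ys)"
  using assms unfolding elem_move_def
proof (elim disjE exE conjE)
  fix us a b c vs
  assume "p = us @ [a, b, c] @ vs" "q = us @ [a, c] @ vs" "I a b" "I b c" "I a c"
  then have "xs @ p @ ys = (xs @ us) @ [a,b,c] @ (vs @ ys) \<and> xs @ q @ ys = (xs @ us) @ [a, c] @ (vs @ ys) \<and> I a b \<and> I b c \<and> I a c"
    by simp
  then show "(\<exists>us a b c vs. xs @ p @ ys = us @ [a, b, c] @ vs \<and> xs @ q @ ys = us @ [a, c] @ vs \<and> I a b \<and> I b c \<and> I a c) \<or>
    (\<exists>us a vs. xs @ p @ ys = us @ [a, a] @ vs \<and> xs @ q @ ys = us @ [a] @ vs)" by blast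
next
  fix us a vs
  assume "p = us @ [a, a] @ vs" "q = us @ [a] @ vs"
  then have "xs @ p @ ys = (xs @ us) @ [a,a] @ (vs @ ys) \<and> xs @ q @ ys = (xs @ us) @ [a] @ (vs @ ys)"
    by simp
  then show "(\<exists>us a b c vs. xs @ p @ ys = us @ [a, b, c] @ vs \<and> xs @ q @ ys = us @ [a, c] @ vs \<and> I a b \<and> I b c \<and> I a c) \<or>
    (\<exists>us a vs. xs @ p @ ys = us @ [a, a] @ vs \<and> xs @ q @ ys = us @ [a] @ vs)" by blast
qed

lemma elem_move_ends:
  assumes "elem_move I p q"
  shows "hd p = hd q" "last p = last q"
  using assms unfolding elem_move_def by (auto simp: hd_append)

locale incidence_graph =
  fixes V :: "'e set" and I :: "'e \<Rightarrow> 'e \<Rightarrow> bool"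
  assumes I_refl: "I a a" and I_sym: "I a b \<Longrightarrow> I b a"
begin

abbreviation htp (infix "\<simeq>" 50) where "p \<simeq> q \<equiv> homotopic V I p q"

lemma htp_refl [simp, intro]: "p \<simeq> p"
  by (simp add: homotopic_def)

lemma htp_trans [trans]: "p \<simeq> q \<Longrightarrow> q \<simeq> r \<Longrightarrow> p \<simeq> r"
  unfolding homotopic_def by (rule rtranclp_trans)

lemma htp_sym: "p \<simeq> q \<Longrightarrow> q \<simeq> p"
  unfolding homotopic_def by (erule sympD[OF symp_rtranclp, rotated]) (auto intro: sympI)

text \<open>Elementary moves keep both end vertices, so the incidences with \<open>xs\<close> and
  \<open>ys\<close> survive every step, and the path property is carried along in the
  induction.\<close>

lemma htp_append:
  assumes "p \<simeq> q" "is_path V I (xs @ p @ ys)"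
  shows "xs @ p @ ys \<simeq> xs @ q @ ys"
proof -
  have "is_path V I (xs @ q @ ys) \<and> xs @ p @ ys \<simeq> xs @ q @ ys"
    using assms(1) unfolding homotopic_def
  proof (induction rule: rtranclp_induct)
    case base
    show ?case using assms(2) by simp
  next
    case (step y z)
    have ends: "hd y = hd z" "last y = last z"
      using step.hyps(2) elem_move_ends by metis+
    have "is_path V I (xs @ z @ ys)"
      using step.hyps(2) step.IH ends
      by (auto simp: is_path_successively successively_append_iff hd_append split: if_splits)
    moreover have "elem_move I (xs @ y @ ys) (xs @ z @ ys) \<or> elem_move I (xs @ z @ ys) (xs @ y @ ys)"
      using step.hyps(2) elem_move_append by metis
    ultimately show ?case
      using step.IH by (auto intro: rtranclp.rtrancl_into_rtrancl)
  qed
  then show ?thesis by simp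
qed

lemma htp_move: "is_path V I p \<Longrightarrow> is_path V I q \<Longrightarrow> elem_move I p q \<Longrightarrow> p \<simeq> q"
  unfolding homotopic_def by (rule r_into_rtranclp) simp

lemma htp_triangle:
  assumes "a \<in> V" "b \<in> V" "c \<in> V" "I a b" "I b c" "I a c"
  shows "[a,b,c] \<simeq> [a,c]"
proof (rule htp_move)
  show "elem_move I [a,b,c] [a,c]"
    unfolding elem_move_def using assms by (intro disjI1 exI[of _ "[]"] exI) auto
qed (use assms in \<open>auto simp: is_path_successively\<close>)

lemma htp_stutter:
  assumes "a \<in> V"
  shows "[a,a] \<simeq> [a]"
proof (rule htp_move)
  show "elem_move I [a,a] [a]"
    unfolding elem_move_def by (intro disjI2 exI[of _ "[]"] exI) auto
qed (use assms I_refl in \<open>auto simp: is_path_successively\<close>)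

lemma htp_backtrack:
  assumes "a \<in> V" "b \<in> V" "I a b"
  shows "[a,b,a] \<simeq> [a]"
  using htp_triangle[of a b a] htp_stutter[of a] assms I_refl I_sym htp_trans by metis

text \<open>The triangles \<open>a, l, b\<close> and \<open>l, b, c\<close> share the edge between
  \<open>l\<close> and \<open>b\<close>, and \<open>[a,l,b,c]\<close> shrinks to either of the two
  paths.\<close>

lemma htp_via:
  assumes "a \<in> V" "b \<in> V" "c \<in> V" "l \<in> V" "I a b" "I b c" "I a l" "I b l" "I c l"
  shows "[a,b,c] \<simeq> [a,l,c]"
proof -
  have "[a,l,b] \<simeq> [a,b]" "[l,b,c] \<simeq> [l,c]"
    using htp_triangle assms I_sym by auto
  then have "[a,l,b,c] \<simeq> [a,b,c]" "[a,l,b,c] \<simeq> [a,l,c]"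
    using htp_append[of "[a,l,b]" "[a,b]" "[]" "[c]"] htp_append[of "[l,b,c]" "[l,c]" "[a]" "[]"] assms I_sym
    by (auto simp: is_path_successively)
  then show ?thesis using htp_sym htp_trans by blast
qed

lemma htp_via_common:
  assumes "a \<in> V" "b \<in> V" "b' \<in> V" "c \<in> V" "l \<in> V" "I a b" "I b c" "I a b'" "I b' c"
    "I a l" "I b l" "I b' l" "I c l"
  shows "[a,b,c] \<simeq> [a,b',c]"
  using htp_via[of a b c l] htp_via[of a b' c l] assms htp_sym htp_trans by blast

lemma is_path_rev: "is_path V I p \<Longrightarrow> is_path V I (rev p)"
  by (auto simp: is_path_successively elim: successively_mono intro: I_sym)

lemma is_path_glue:
  assumes "is_path V I p" "is_path V I q" "last p = hd q"
  shows "is_path V I (p @ tl q)"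
  using assms by (cases q) (auto simp: is_path_successively successively_append_iff successively_Cons)

text \<open>Backtracks cancel from the middle outwards, starting at the turning vertex
  \<open>hd p\<close>; \<open>tl\<close> keeps that vertex from being listed twice.\<close>

lemma htp_rev_tl:
  assumes "is_path V I p"
  shows "rev p @ tl p \<simeq> [last p]"
  using assms
proof (induction p)
  case (Cons a p)
  show ?case
  proof (cases p)
    case (Cons b p')
    have pth: "is_path V I p" using Cons.prems Cons by (auto simp: is_path_successively)
    have ab: "[b,a,b] \<simeq> [b]"
      using htp_backtrack[of b a] Cons.prems Cons I_sym by (auto simp: is_path_successively)
    have "is_path V I (rev (a # p) @ tl (a # p))"
      using is_path_glue[OF is_path_rev[OF Cons.prems] Cons.prems] by (simp add: last_rev)
    then have "is_path V I (rev p' @ [b,a,b] @ p')" unfolding Cons by simp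
    then have "rev p' @ [b,a,b] @ p' \<simeq> rev p' @ [b] @ p'"
      by (rule htp_append[OF ab])
    also have "rev p' @ [b] @ p' \<simeq> [last p]"
      using Cons.IH[OF pth] unfolding Cons by simp
    finally show ?thesis unfolding Cons by simp
  qed simp
qed (simp add: is_path_successively)

end

section \<open>Flat geometries\<close>

locale flat_geometry = incidence_graph V I for V :: "'e set" and I +
  fixes Ps Ls Ss :: "'e set"
  assumes V_eq: "V = Ps \<union> Ls \<union> Ss"
    and flat: "p \<in> Ps \<Longrightarrow> s \<in> Ss \<Longrightarrow> I p s"
    and line_point: "l \<in> Ls \<Longrightarrow> \<exists>p\<in>Ps. I p l"
    and line_plane: "l \<in> Ls \<Longrightarrow> \<exists>s\<in>Ss. I s l"
    and same_type: "I a b \<Longrightarrow> a \<in> Ps \<and> b \<in> Ps \<or> a \<in> Ls \<and> b \<in> Ls \<or> a \<in> Ss \<and> b \<in> Ss \<Longrightarrow> a = b"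
begin

lemma flat': "p \<in> Ps \<Longrightarrow> s \<in> Ss \<Longrightarrow> I s p"
  using flat I_sym by blast

lemmas path_simps = is_path_successively V_eq flat flat'

text \<open>Inserting the backtrack \<open>s, q, s\<close> splits the path at \<open>q\<close>; once
  both halves run through \<open>t\<close>, the detour is removed again.\<close>

lemma square_trans_point:
  assumes "[p,s,q] \<simeq> [p,t,q]" "[q,s,r] \<simeq> [q,t,r]" "p \<in> Ps" "q \<in> Ps" "r \<in> Ps" "s \<in> Ss" "t \<in> Ss"
  shows "[p,s,r] \<simeq> [p,t,r]"
proof -
  have "[p,s,r] \<simeq> [p,s,q,s,r]"
    using htp_append[OF htp_sym[OF htp_backtrack[of s q]], of "[p]" "[r]"] assms by (auto simp: path_simps)
  also have "[p,s,q,s,r] \<simeq> [p,s,q,t,r]"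
    using htp_append[OF assms(2), of "[p,s]" "[]"] assms by (auto simp: path_simps)
  also have "[p,s,q,t,r] \<simeq> [p,t,q,t,r]"
    using htp_append[OF assms(1), of "[]" "[t,r]"] assms by (auto simp: path_simps)
  also have "[p,t,q,t,r] \<simeq> [p,t,r]"
    using htp_append[OF htp_backtrack[of t q], of "[p]" "[r]"] assms by (auto simp: path_simps)
  finally show ?thesis .
qed

lemma loop_cong:
  assumes "[r,s',q] \<simeq> [r,t',q]" "[q,s,r] \<simeq> [q,t,r]"
    "r \<in> Ps" "q \<in> Ps" "s \<in> Ss" "s' \<in> Ss" "t \<in> Ss" "t' \<in> Ss"
  shows "[r,s',q,s,r] \<simeq> [r,t',q,t,r]"
proof -
  have "[r,s',q,s,r] \<simeq> [r,t',q,s,r]"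
    using htp_append[OF assms(1), of "[]" "[s,r]"] assms by (auto simp: path_simps)
  also have "[r,t',q,s,r] \<simeq> [r,t',q,t,r]"
    using htp_append[OF assms(2), of "[r,t']" "[]"] assms by (auto simp: path_simps)
  finally show ?thesis .
qed

text \<open>Right cancellation as in a groupoid: appending \<open>[s,q]\<close> undoes the common
  second half of the loops.\<close>

lemma loop_cancel:
  assumes "[r,s',q,s,r] \<simeq> [r,t',q,s,r]" "r \<in> Ps" "q \<in> Ps" "s \<in> Ss" "s' \<in> Ss" "t' \<in> Ss"
  shows "[r,s',q] \<simeq> [r,t',q]"
proof -
  have *: "[r,t,q,s,r,s,q] \<simeq> [r,t,q]" if "t \<in> Ss" for t
  proof -
    have "[r,t,q,s,r,s,q] \<simeq> [r,t,q,s,q]"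
      using htp_append[OF htp_backtrack[of s r], of "[r,t,q]" "[q]"] assms that by (auto simp: path_simps)
    also have "[r,t,q,s,q] \<simeq> [r,t,q]"
      using htp_append[OF htp_backtrack[of q s], of "[r,t]" "[]"] assms that by (auto simp: path_simps)
    finally show ?thesis .
  qed
  have "[r,s',q,s,r,s,q] \<simeq> [r,t',q,s,r,s,q]"
    using htp_append[OF assms(1), of "[]" "[s,q]"] assms by (auto simp: path_simps)
  then show ?thesis using * assms htp_sym htp_trans by meson
qed

lemma loop_swap_point:
  assumes "[s',q,s] \<simeq> [s',p,s]" "r \<in> Ps" "q \<in> Ps" "p \<in> Ps" "s \<in> Ss" "s' \<in> Ss"
  shows "[r,s',q,s,r] \<simeq> [r,s',p,s,r]"
  using htp_append[OF assms(1), of "[r]" "[r]"] assms by (auto simp: path_simps)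

lemma loop_null_iff:
  assumes "r \<in> Ps" "q \<in> Ps" "s \<in> Ss" "s' \<in> Ss"
  shows "[r,s',q,s,r] \<simeq> [r] \<longleftrightarrow> [r,s',q] \<simeq> [r,s,q]"
proof -
  have *: "[r,s,q,s,r] \<simeq> [r]"
    using htp_rev_tl[of "[q,s,r]"] assms by (auto simp: path_simps)
  show ?thesis
  proof
    assume "[r,s',q,s,r] \<simeq> [r]"
    then have "[r,s',q,s,r] \<simeq> [r,s,q,s,r]" using * htp_sym htp_trans by blast
    then show "[r,s',q] \<simeq> [r,s,q]" using loop_cancel assms by blast
  next
    assume "[r,s',q] \<simeq> [r,s,q]"
    then show "[r,s',q,s,r] \<simeq> [r]" using loop_cong[of r s' q s s s] assms * htp_trans by blast
  qed
qed

text \<open>Each element \<open>x\<close> has a distinguished homotopy class of paths from the base point to \<open>x\<close>, and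
  these classes are compatible with incidence, which is a section of the universal covering.\<close>

lemma simply_connectedI:
  assumes sq: "\<And>p q s t. p \<in> Ps \<Longrightarrow> q \<in> Ps \<Longrightarrow> s \<in> Ss \<Longrightarrow> t \<in> Ss \<Longrightarrow> [p,s,q] \<simeq> [p,t,q]"
    and p0: "p0 \<in> Ps" and s0: "s0 \<in> Ss"
  shows "simply_connected V I"
proof -
  \<comment> \<open>The plane \<open>s\<close> on the way to a point or a line is left open, so
    \<open>K\<close> is a relation; \<open>sq\<close> and \<open>pls\<close> show that all choices
    are homotopic.\<close>
  define K where "K x k \<longleftrightarrow> (x \<in> Ps \<and> (\<exists>s\<in>Ss. k = [p0,s,x])) \<or> (x \<in> Ss \<and> k = [p0,x]) \<or>
      (x \<in> Ls \<and> (\<exists>s\<in>Ss. I s x \<and> k = [p0,s,x]))" for x k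
  have K_ex: "\<exists>k. K x k" if "x \<in> V" for x
    using that s0 line_plane unfolding K_def V_eq by blast
  have K_path: "is_path V I k \<and> hd k = p0 \<and> last k = x" if "K x k" for x k
    using that p0 unfolding K_def by (auto simp: path_simps)
  have sl: "[s,q,l] \<simeq> [s,l]" "[s,l,q] \<simeq> [s,q]"
    if "l \<in> Ls" "s \<in> Ss" "I s l" "q \<in> Ps" "I q l" for l s q
    by (rule htp_triangle; use that V_eq flat' I_sym in blast)+
  have pls: "[p0,s,l] \<simeq> [p0,t,l]" if "l \<in> Ls" "s \<in> Ss" "t \<in> Ss" "I s l" "I t l" for l s t
  proof -
    obtain q where q: "q \<in> Ps" "I q l" using line_point \<open>l \<in> Ls\<close> by blast
    have "[p0,s,l] \<simeq> [p0,s,q,l]"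
      using htp_append[OF htp_sym[OF sl(1)], of l s q "[p0]" "[]"] that q p0 by (auto simp: path_simps)
    also have "[p0,s,q,l] \<simeq> [p0,t,q,l]"
      using htp_append[OF sq, of p0 q s t "[]" "[l]"] that q p0 by (auto simp: path_simps)
    also have "[p0,t,q,l] \<simeq> [p0,t,l]"
      using htp_append[OF sl(1), of l t q "[p0]" "[]"] that q p0 by (auto simp: path_simps)
    finally show ?thesis .
  qed
  have sqs: "[p0,s,q,t] \<simeq> [p0,t]" if "q \<in> Ps" "s \<in> Ss" "t \<in> Ss" for q s t
  proof -
    have "[p0,s,q,t] \<simeq> [p0,t,q,t]"
      using htp_append[OF sq, of p0 q s t "[]" "[t]"] that p0 by (auto simp: path_simps)
    also have "[p0,t,q,t] \<simeq> [p0,t]"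
      using htp_append[OF htp_backtrack[of t q], of "[p0]" "[]"] that p0 by (auto simp: path_simps)
    finally show ?thesis .
  qed
  have K_step: "k @ [y] \<simeq> k'" if kx: "K x k" and ky: "K y k'" and xy: "I x y" for x y k k'
  proof -
    have st: "k @ [y] \<simeq> k" if "x = y"
    proof -
      have "k = butlast k @ [y]" "is_path V I (k @ [y])" "y \<in> V"
        using K_path[OF kx] that I_refl ky
        by (auto simp: is_path_successively successively_append_iff K_def V_eq)
      then show ?thesis
        using htp_append[OF htp_stutter[of y], of "butlast k" "[]"] by (metis append.assoc append_Cons append_Nil append_Nil2)
    qed
    have yx: "I y x" using xy I_sym by blast
    consider (PP) s t where "x \<in> Ps" "y \<in> Ps" "s \<in> Ss" "t \<in> Ss" "k = [p0,s,x]" "k' = [p0,t,y]"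
      | (PL) s t where "x \<in> Ps" "y \<in> Ls" "s \<in> Ss" "t \<in> Ss" "I t y" "k = [p0,s,x]" "k' = [p0,t,y]"
      | (PS) s where "x \<in> Ps" "y \<in> Ss" "s \<in> Ss" "k = [p0,s,x]" "k' = [p0,y]"
      | (LP) s t where "x \<in> Ls" "y \<in> Ps" "s \<in> Ss" "I s x" "t \<in> Ss" "k = [p0,s,x]" "k' = [p0,t,y]"
      | (LL) s t where "x \<in> Ls" "y \<in> Ls" "s \<in> Ss" "I s x" "t \<in> Ss" "I t y" "k = [p0,s,x]" "k' = [p0,t,y]"
      | (LS) s where "x \<in> Ls" "y \<in> Ss" "s \<in> Ss" "I s x" "k = [p0,s,x]" "k' = [p0,y]"
      | (SP) t where "x \<in> Ss" "y \<in> Ps" "t \<in> Ss" "k = [p0,x]" "k' = [p0,t,y]"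
      | (SL) t where "x \<in> Ss" "y \<in> Ls" "t \<in> Ss" "I t y" "k = [p0,x]" "k' = [p0,t,y]"
      | (SS) "x \<in> Ss" "y \<in> Ss" "k = [p0,x]" "k' = [p0,y]"
      using kx ky unfolding K_def by metis
    then show ?thesis
    proof cases
      case PP
      then show ?thesis using st same_type[OF xy] sq[OF p0] htp_trans by blast
    next
      case PL
      have "[p0,s,x,y] \<simeq> [p0,t,x,y]"
        using htp_append[OF sq, of p0 x s t "[]" "[y]"] PL p0 xy by (auto simp: path_simps)
      also have "[p0,t,x,y] \<simeq> [p0,t,y]"
        using htp_append[OF sl(1), of y t x "[p0]" "[]"] PL p0 xy by (auto simp: path_simps)
      finally show ?thesis using PL by simp
    next
      case PS
      then show ?thesis using sqs by simp
    next
      case LP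
      have "[p0,s,x,y] \<simeq> [p0,s,y]"
        using htp_append[OF sl(2), of x s y "[p0]" "[]"] LP p0 xy yx by (auto simp: path_simps)
      also have "[p0,s,y] \<simeq> [p0,t,y]" using sq p0 LP by blast
      finally show ?thesis using LP by simp
    next
      case LL
      then show ?thesis using st same_type[OF xy] pls htp_trans by blast
    next
      case LS
      obtain q where q: "q \<in> Ps" "I q x" using line_point \<open>x \<in> Ls\<close> by blast
      have "[p0,s,x,y] \<simeq> [p0,s,q,y]"
        using htp_append[OF htp_via[of s x y q], of "[p0]" "[]"] LS p0 q xy yx I_sym by (auto simp: path_simps)
      also have "[p0,s,q,y] \<simeq> [p0,y]" using sqs LS q by blast
      finally show ?thesis using LS by simp
    next
      case SP
      then show ?thesis using sq p0 by simp
    next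
      case SL
      then show ?thesis using pls xy by simp
    next
      case SS
      then show ?thesis using st same_type[OF xy] by simp
    qed
  qed
  \<comment> \<open>Path lifting: edges are added at the right end, and each one is absorbed by
    \<open>K_step\<close>.\<close>
  have K_follow: "k @ tl p \<simeq> k'" if "is_path V I p" "K (hd p) k" "K (last p) k'" for p k k'
  proof -
    have "p \<noteq> []" using that by (simp add: is_path_def)
    then show ?thesis using that
    proof (induction p arbitrary: k' rule: rev_nonempty_induct)
      case (single x)
      have "k \<simeq> k'"
      proof -
        have "k @ [x] \<simeq> k'" "k @ [x] \<simeq> k" using K_step[of x k x] single I_refl by auto
        then show ?thesis using htp_sym htp_trans by blast
      qed
      then show ?case by simp
    next
      case (snoc y p)
      have p: "is_path V I p" "I (last p) y" "last p \<in> V"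
        using snoc.prems(1) snoc.hyps by (auto simp: is_path_successively successively_append_iff)
      obtain k1 where k1: "K (last p) k1" using K_ex p by blast
      have kp: "K (hd p) k" using snoc.prems snoc.hyps by simp
      have "is_path V I (k @ tl (p @ [y]))"
        using is_path_glue[of k "p @ [y]"] K_path[OF kp] snoc.prems snoc.hyps by simp
      then have "k @ tl p @ [y] \<simeq> k1 @ [y]"
        using htp_append[OF snoc.IH[OF p(1) kp k1], of "[]" "[y]"] snoc.hyps by simp
      also have "k1 @ [y] \<simeq> k'" using K_step[OF k1 _ p(2)] snoc.prems by simp
      finally show ?case using snoc.hyps by simp
    qed
  qed
  show ?thesis
    unfolding simply_connected_def
  proof (intro conjI ballI allI impI)
    fix a b assume "a \<in> V" "b \<in> V"
    then obtain k k' where k: "K a k" "K b k'" using K_ex by blast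
    have kk: "k \<noteq> []" "k' \<noteq> []" "tl k' = [] \<Longrightarrow> hd k' = last k'"
      using K_path[OF k(1)] K_path[OF k(2)] by (auto simp: is_path_def) (metis list.collapse last_ConsL)
    have "is_path V I (rev k @ tl k')"
      using is_path_glue[OF is_path_rev, of k k'] K_path[OF k(1)] K_path[OF k(2)] kk by (simp add: last_rev)
    moreover have "hd (rev k @ tl k') = a" using K_path[OF k(1)] kk by (simp add: hd_rev)
    moreover have "last (rev k @ tl k') = b" using K_path[OF k(1)] K_path[OF k(2)] kk by (auto simp: last_append last_rev last_tl)
    ultimately show "\<exists>p. is_path V I p \<and> hd p = a \<and> last p = b" by blast
  next
    fix p assume p: "is_path V I p \<and> hd p = last p"
    then have "p \<noteq> []" "hd p \<in> V" by (auto simp: is_path_def)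
    then obtain k where k: "K (hd p) k" using K_ex by blast
    note kp = K_path[OF k]
    have kne: "k \<noteq> []" using kp by (simp add: is_path_def)
    have k1: "k = p0 # tl k" "p = hd p # tl p" using kp kne \<open>p \<noteq> []\<close> by (metis list.collapse)+
    then have rk: "rev k = rev (tl k) @ [p0]" by (metis rev.simps(2))
    have pk: "is_path V I (rev k @ tl k)"
      using is_path_glue[OF is_path_rev, of k k] kp kne by (simp add: last_rev)
    have lk: "last (rev k @ tl k) = hd p"
      using kp kne k1 by (metis last_ConsR last_append last_rev self_append_conv list.sel(1) last_ConsL append_Nil2)
    have pkp: "is_path V I (rev k @ tl k @ tl p)"
      using is_path_glue[OF pk, of p] lk p by simp
    \<comment> \<open>Before \<open>p\<close> a trip to \<open>p0\<close> and back is inserted. As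
      \<open>p\<close> is closed, \<open>K_follow\<close> then absorbs \<open>p\<close> into the
      return trip \<open>k\<close>.\<close>
    have "p \<simeq> rev k @ tl k @ tl p"
      using htp_append[OF htp_rev_tl, of k "[]" "tl p"] kp pkp k1(2) by (metis append.assoc append_Cons append_Nil htp_sym)
    also have "rev k @ tl k @ tl p \<simeq> rev k @ tl k"
    proof -
      have "k @ tl p \<simeq> k" using K_follow[of p k k] p k by simp
      moreover have "rev k @ tl k @ tl p = rev (tl k) @ (k @ tl p) @ []" "rev k @ tl k = rev (tl k) @ k @ []"
        using k1(1) rk by (metis append.assoc append_Cons append_Nil append_Nil2)+
      ultimately show ?thesis using htp_append[of "k @ tl p" k "rev (tl k)" "[]"] pkp by metis
    qed
    also have "rev k @ tl k \<simeq> [hd p]" using htp_rev_tl kp by metis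
    finally show "p \<simeq> [hd p]" .
  qed
qed

end

section \<open>Octonion arithmetic\<close>

lemmas oct_unfold = omul_def ocnj_def qmul_def qcnj_def qneg_def qadd_def

lemma oadd_eq: "oadd x y = x + y"
  by (simp add: oadd_def qadd_def prod_eq_iff)

lemma ozero_eq: "ozero = 0"
  by (simp add: ozero_def prod_eq_iff)

lemma ipR_eq: "ipR x y = x \<bullet> y"
  by (simp add: ipR_def ore_def oct_unfold inner_prod_def inner_complex_def)

lemma omul_add_left: "omul (x + y) z = omul x z + omul y z"
  by (simp add: oct_unfold prod_eq_iff algebra_simps)

lemma omul_add_right: "omul z (x + y) = omul z x + omul z y"
  by (simp add: oct_unfold prod_eq_iff algebra_simps)

lemma omul_scaleR_left [simp]: "omul (r *\<^sub>R x) y = r *\<^sub>R omul x y"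
  by (simp add: oct_unfold prod_eq_iff algebra_simps scaleR_conv_of_real)

lemma omul_scaleR_right [simp]: "omul x (r *\<^sub>R y) = r *\<^sub>R omul x y"
  by (simp add: oct_unfold prod_eq_iff algebra_simps scaleR_conv_of_real)

lemma omul_minus_left [simp]: "omul (- x) y = - omul x y"
  using omul_scaleR_left[of "-1" x y] by simp

lemma omul_minus_right [simp]: "omul x (- y) = - omul x y"
  using omul_scaleR_right[of x "-1" y] by simp

lemma omul_diff_left: "omul (x - y) z = omul x z - omul y z"
  using omul_add_left[of x "- y" z] by simp

lemma omul_diff_right: "omul z (x - y) = omul z x - omul z y"
  using omul_add_right[of z x "- y"] by simp

lemmas omul_distribs = omul_add_left omul_add_right omul_diff_left omul_diff_right

definition oone :: oct where "oone = ((1, 0), (0, 0))"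

lemma omul_oone [simp]: "omul oone x = x" "omul x oone = x"
  by (simp_all add: oone_def oct_unfold)

lemma ofR_eq: "ofR r = r *\<^sub>R oone"
  by (simp add: ofR_def ofC_def oone_def prod_eq_iff scaleR_conv_of_real)

lemma inner_oone [simp]: "oone \<bullet> oone = 1"
  by (simp add: oone_def inner_prod_def)

lemma oone_neq_0: "oone \<noteq> 0"
  using inner_oone by force

lemma ocnj_eq: "ocnj x = (2 * (x \<bullet> oone)) *\<^sub>R oone - x"
  by (simp add: oone_def oct_unfold prod_eq_iff inner_prod_def inner_complex_def complex_eq_iff)

lemma ocnj_add [simp]: "ocnj (x + y) = ocnj x + ocnj y"
  by (simp add: oct_unfold prod_eq_iff)

lemma ocnj_ocnj [simp]: "ocnj (ocnj x) = x"
  by (simp add: oct_unfold prod_eq_iff)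

lemma ocnj_omul: "ocnj (omul x y) = omul (ocnj y) (ocnj x)"
  by (simp add: oct_unfold prod_eq_iff algebra_simps)

lemma inner_omul_left: "omul a b \<bullet> c = b \<bullet> omul (ocnj a) c"
  by (simp add: oct_unfold inner_prod_def inner_complex_def algebra_simps)

lemma inner_omul_right: "omul a b \<bullet> c = a \<bullet> omul c (ocnj b)"
  by (simp add: oct_unfold inner_prod_def inner_complex_def algebra_simps)

lemma inner_via_product: "x \<bullet> y = omul (ocnj x) y \<bullet> oone"
  using inner_omul_left[of "ocnj x" y oone] by (simp add: inner_commute)

text \<open>Polarisation of the law that multiplying by \<open>x\<close> and then by its conjugate
  scales by the squared norm. It stands in for associativity: for orthogonal \<open>x\<close> and
  \<open>y\<close> the two outer factors may be exchanged at the price of a sign.\<close>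

lemma left_alternative_linearised:
  "omul (ocnj x) (omul y z) + omul (ocnj y) (omul x z) = (2 * (x \<bullet> y)) *\<^sub>R z"
  by (simp add: oct_unfold prod_eq_iff inner_prod_def inner_complex_def complex_eq_iff algebra_simps)

lemma right_alternative_linearised:
  "omul (omul z y) (ocnj x) + omul (omul z x) (ocnj y) = (2 * (x \<bullet> y)) *\<^sub>R z"
  by (simp add: oct_unfold prod_eq_iff inner_prod_def inner_complex_def complex_eq_iff algebra_simps)

lemma imaginary_cnj: "x \<bullet> oone = 0 \<Longrightarrow> ocnj x = - x"
  by (simp add: ocnj_eq)

lemma inner_ocnj_imaginary: "w \<bullet> oone = 0 \<Longrightarrow> w \<bullet> ocnj x = - (w \<bullet> x)"
  by (simp add: ocnj_eq inner_diff_right)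

lemma cnj_anticommute:
  assumes "x \<bullet> y = 0"
  shows "omul (ocnj x) y = - omul (ocnj y) x"
  using left_alternative_linearised[of x y oone] assms by (simp add: eq_neg_iff_add_eq_0)

lemma imaginary_anticommute:
  assumes "x \<bullet> y = 0" "x \<bullet> oone = 0" "y \<bullet> oone = 0"
  shows "omul x y = - omul y x"
  using cnj_anticommute[OF assms(1)] assms by (metis imaginary_cnj minus_minus omul_minus_left)

lemma left_alternative: "omul (ocnj x) (omul x z) = (x \<bullet> x) *\<^sub>R z"
proof -
  have "2 *\<^sub>R omul (ocnj x) (omul x z) = 2 *\<^sub>R ((x \<bullet> x) *\<^sub>R z)"
    using left_alternative_linearised[of x x z] by (simp add: scaleR_2)
  then show ?thesis by (simp only: scaleR_cancel_left) simp
qed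

lemma right_alternative: "omul (omul z x) (ocnj x) = (x \<bullet> x) *\<^sub>R z"
proof -
  have "2 *\<^sub>R omul (omul z x) (ocnj x) = 2 *\<^sub>R ((x \<bullet> x) *\<^sub>R z)"
    using right_alternative_linearised[of z x x] by (simp add: scaleR_2)
  then show ?thesis by (simp only: scaleR_cancel_left) simp
qed

text \<open>This is the formula defining \<open>qmul\<close> and \<open>omul\<close>, now for a
  doubling inside the octonions. The orthogonality of \<open>w\<close> is required only for the
  elements that occur, so no subalgebra has to be introduced. Each of the four products is found by
  moving \<open>w\<close> with the linearised alternative laws.\<close>

lemma cayley_dickson_rule:
  assumes w: "w \<bullet> oone = 0" "w \<bullet> w = 1"
    and orth: "w \<bullet> a = 0" "w \<bullet> b = 0" "w \<bullet> c = 0" "w \<bullet> d = 0" "w \<bullet> omul d a = 0" "w \<bullet> omul (ocnj b) d = 0"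
  shows "omul (a + omul b w) (c + omul d w) =
    (omul a c - omul (ocnj d) b) + omul (omul d a + omul b (ocnj c)) w"
proof -
  note wc = imaginary_cnj[OF w(1)]
  have comm: "omul x w = omul w (ocnj x)" if "w \<bullet> x = 0" for x
    using cnj_anticommute[of w "ocnj x"] that inner_ocnj_imaginary[OF w(1), of x] by (simp add: wc)
  have l: "omul x (omul w z) = omul w (omul (ocnj x) z)" if "w \<bullet> x = 0" for x z
    using left_alternative_linearised[of "ocnj x" w z] that inner_ocnj_imaginary[OF w(1), of x]
    by (simp add: wc inner_commute)
  have r: "omul (omul z w) x = omul (omul z (ocnj x)) w" if "w \<bullet> x = 0" for x z
    using right_alternative_linearised[of z w "ocnj x"] that inner_ocnj_imaginary[OF w(1), of x]
    by (simp add: wc inner_commute)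
  have 1: "omul a (omul d w) = omul (omul d a) w"
    using comm[of d] comm[of "omul d a"] l[of a "ocnj d"] orth by (simp add: ocnj_omul)
  have 2: "omul (omul b w) c = omul (omul b (ocnj c)) w"
    using r orth by blast
  \<comment> \<open>For the product of the two \<open>w\<close>-parts, orthogonality lets
    \<open>omul b w\<close> and \<open>d\<close> change places, which brings the two factors
    \<open>w\<close> together.\<close>
  have "omul b w \<bullet> d = 0" using orth inner_omul_left[of b w d] by simp
  then have "omul (ocnj (omul b w)) (omul d w) = - omul (ocnj d) (omul (omul b w) w)"
    using left_alternative_linearised[of "omul b w" d w] by (simp add: eq_neg_iff_add_eq_0)
  moreover have "omul (omul b w) w = - b"
  proof -
    have "- omul (omul b w) w = b" using right_alternative[of b w] w by (simp add: wc)
    then show ?thesis by (metis minus_minus)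
  qed
  moreover have "ocnj (omul b w) = - omul b w"
    using comm[of b] orth by (simp add: ocnj_omul wc)
  ultimately have 3: "omul (omul b w) (omul d w) = - omul (ocnj d) b"
    by (metis minus_minus omul_minus_left omul_minus_right)
  show ?thesis
    by (simp add: omul_distribs 1 2 3)
qed

section \<open>Automorphisms of the octonions\<close>

definition oaut :: "(oct \<Rightarrow> oct) \<Rightarrow> bool" where
  "oaut g \<longleftrightarrow> linear g \<and> g oone = oone \<and> (\<forall>x y. g (omul x y) = omul (g x) (g y)) \<and> (\<forall>x y. g x \<bullet> g y = x \<bullet> y)"

lemma
  assumes "oaut g"
  shows oaut_linear: "linear g" and oaut_oone: "g oone = oone"
    and oaut_omul: "g (omul x y) = omul (g x) (g y)" and oaut_inner: "g x \<bullet> g y = x \<bullet> y"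
  using assms unfolding oaut_def by blast+

lemma oaut_bij: "oaut g \<Longrightarrow> bij g"
proof -
  assume g: "oaut g"
  have "inj g"
  proof (rule injI)
    fix x y assume "g x = g y"
    then have "g (x - y) \<bullet> g (x - y) = 0" by (simp add: linear_diff[OF oaut_linear[OF g]])
    then show "x = y" by (simp add: oaut_inner[OF g])
  qed
  then show "bij g"
    using linear_injective_imp_surjective[OF oaut_linear[OF g]] by (simp add: bij_def)
qed

lemma oaut_comp: "oaut g \<Longrightarrow> oaut h \<Longrightarrow> oaut (g \<circ> h)"
  by (simp add: oaut_def linear_compose del: split_paired_All)

lemma oaut_inv:
  assumes g: "oaut g"
  shows "oaut (inv g)"
proof -
  note b = oaut_bij[OF g]
  have gi: "g (inv g x) = x" for x using b by (simp add: bij_is_surj surj_f_inv_f)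
  have ig: "inv g (g x) = x" for x using b by (simp add: bij_is_inj inv_f_f)
  have "linear (inv g)"
  proof (rule linearI)
    fix x y r
    show "inv g (x + y) = inv g x + inv g y"
      using linear_add[OF oaut_linear[OF g], of "inv g x" "inv g y"] by (metis gi ig)
    show "inv g (r *\<^sub>R x) = r *\<^sub>R inv g x"
      using linear_scale[OF oaut_linear[OF g], of r "inv g x"] by (metis gi ig)
  qed
  moreover have "inv g (omul x y) = omul (inv g x) (inv g y)" for x y
    using oaut_omul[OF g, of "inv g x" "inv g y"] by (metis gi ig)
  moreover have "inv g x \<bullet> inv g y = x \<bullet> y" for x y
    using oaut_inner[OF g, of "inv g x" "inv g y"] by (simp add: gi)
  moreover have "inv g oone = oone" using ig[of oone] oaut_oone[OF g] by simp
  ultimately show ?thesis by (simp add: oaut_def del: split_paired_All)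
qed

text \<open>Here \<open>n\<close> generates a copy of the complex numbers, \<open>a\<close> is
  orthogonal to it and doubles it to a quaternion algebra, and \<open>b\<close> is orthogonal to
  \<open>oone\<close>, \<open>n\<close>, \<open>a\<close>, \<open>na\<close>, the span of that
  algebra, and doubles it to the octonions.\<close>

definition basic_triple :: "oct \<Rightarrow> oct \<Rightarrow> oct \<Rightarrow> bool" where
  "basic_triple n a b \<longleftrightarrow> n \<bullet> oone = 0 \<and> n \<bullet> n = 1 \<and> a \<bullet> oone = 0 \<and> a \<bullet> a = 1 \<and> a \<bullet> n = 0 \<and>
     b \<bullet> oone = 0 \<and> b \<bullet> b = 1 \<and> b \<bullet> n = 0 \<and> b \<bullet> a = 0 \<and> b \<bullet> omul n a = 0"

definition cmap :: "oct \<Rightarrow> complex \<Rightarrow> oct" where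
  "cmap n z = Re z *\<^sub>R oone + Im z *\<^sub>R n"

definition qmap :: "oct \<Rightarrow> oct \<Rightarrow> quat \<Rightarrow> oct" where
  "qmap n a p = cmap n (fst p) + omul (cmap n (snd p)) a"

definition omap :: "oct \<Rightarrow> oct \<Rightarrow> oct \<Rightarrow> oct \<Rightarrow> oct" where
  "omap n a b x = qmap n a (fst x) + omul (qmap n a (snd x)) b"

context
  fixes n a b :: oct
  assumes t: "basic_triple n a b"
begin

lemma cmap_mult: "cmap n (z * w) = omul (cmap n z) (cmap n w)"
proof -
  have "- omul n n = oone"
    using left_alternative[of n oone] imaginary_cnj[of n] t by (simp add: basic_triple_def)
  then have "omul n n = - oone" by (metis minus_minus)
  then show ?thesis
    by (simp add: cmap_def omul_distribs algebra_simps)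
qed

lemma cmap_cnj: "cmap n (cnj z) = ocnj (cmap n z)"
  using t by (simp add: cmap_def ocnj_eq inner_simps basic_triple_def scaleR_2[symmetric] algebra_simps)

lemma cmap_add: "cmap n (z + w) = cmap n z + cmap n w"
  by (simp add: cmap_def algebra_simps)

lemma cmap_diff: "cmap n (z - w) = cmap n z - cmap n w"
  by (simp add: cmap_def algebra_simps)

lemma cmap_minus: "cmap n (- z) = - cmap n z"
  by (simp add: cmap_def)

lemma inner_cmap: "a \<bullet> cmap n z = 0" "b \<bullet> cmap n z = 0"
  using t by (simp_all add: cmap_def inner_simps basic_triple_def)

lemma qmap_add: "qmap n a (p + q) = qmap n a p + qmap n a q"
  by (simp add: qmap_def cmap_add omul_distribs)

lemma qmap_diff: "qmap n a (p - q) = qmap n a p - qmap n a q"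
  by (simp add: qmap_def cmap_diff omul_distribs)

lemma qmap_qmul: "qmap n a (qmul p q) = omul (qmap n a p) (qmap n a q)"
  unfolding qmap_def
  by (subst cayley_dickson_rule)
    (use t in \<open>simp_all add: qmul_def cmap_mult[symmetric] cmap_cnj[symmetric] inner_cmap cmap_add[symmetric]
      cmap_diff[symmetric] basic_triple_def\<close>)

lemma ocnj_doubling:
  assumes "w \<bullet> oone = 0" "w \<bullet> x = 0"
  shows "ocnj (omul x w) = - omul x w"
  using assms cnj_anticommute[of w "ocnj x"] inner_ocnj_imaginary[of w x] by (simp add: ocnj_omul imaginary_cnj)

lemma qmap_qcnj: "qmap n a (qcnj p) = ocnj (qmap n a p)"
  using t ocnj_doubling[of a "cmap n (snd p)"] inner_cmap
  by (simp add: qmap_def qcnj_def cmap_cnj cmap_minus basic_triple_def)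

lemma inner_qmap: "b \<bullet> qmap n a p = 0"
  using t by (simp add: qmap_def inner_simps inner_cmap cmap_def[of _ "snd p"] omul_distribs basic_triple_def)

lemma omap_omul: "omap n a b (omul x y) = omul (omap n a b x) (omap n a b y)"
proof -
  have "fst (omul x y) = qmul (fst x) (fst y) - qmul (qcnj (snd y)) (snd x)"
    "snd (omul x y) = qmul (snd y) (fst x) + qmul (snd x) (qcnj (fst y))"
    by (simp_all add: omul_def qadd_def qneg_def prod_eq_iff)
  then show ?thesis
    unfolding omap_def
    by (subst cayley_dickson_rule)
      (use t in \<open>simp_all add: qmap_qmul[symmetric] qmap_qcnj[symmetric] inner_qmap qmap_add[symmetric]
        qmap_diff[symmetric] basic_triple_def\<close>)
qed

lemma omap_ocnj: "omap n a b (ocnj x) = ocnj (omap n a b x)"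
proof -
  have "qmap n a (qneg q) = - qmap n a q" for q
    by (simp add: qmap_def qneg_def cmap_minus)
  then show ?thesis
    using t ocnj_doubling[of b "qmap n a (snd x)"] inner_qmap
    by (simp add: omap_def ocnj_def[of x] qmap_qcnj basic_triple_def)
qed

lemma omap_inner_oone: "omap n a b x \<bullet> oone = x \<bullet> oone"
proof -
  have "omul y w \<bullet> oone = 0" if "w \<bullet> oone = 0" "w \<bullet> y = 0" for y w
    using that inner_omul_left[of y w oone] inner_ocnj_imaginary[of w y] by simp
  then have "omap n a b x \<bullet> oone = cmap n (fst (fst x)) \<bullet> oone"
    using t by (simp add: omap_def qmap_def[of n a "fst x"] inner_add_left inner_qmap inner_cmap basic_triple_def)
  also have "\<dots> = x \<bullet> oone"
    using t by (simp add: cmap_def inner_simps basic_triple_def) (simp add: oone_def inner_prod_def inner_complex_def)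
  finally show ?thesis .
qed

lemma omap_linear: "linear (omap n a b)"
proof (rule linearI)
  fix x y r
  show "omap n a b (x + y) = omap n a b x + omap n a b y"
    by (simp add: omap_def qmap_add omul_distribs)
  show "omap n a b (r *\<^sub>R x) = r *\<^sub>R omap n a b x"
    by (simp add: omap_def qmap_def cmap_def omul_distribs scaleR_add_right)
qed

text \<open>The isometry property comes from the algebra: \<open>x \<bullet> y\<close> is the real
  part of \<open>omul (ocnj x) y\<close>, and \<open>omap\<close> respects products, conjugation and
  real parts.\<close>

lemma omap_oaut: "oaut (omap n a b)"
  unfolding oaut_def
proof (intro conjI allI omap_linear omap_omul)
  show "omap n a b oone = oone"
    \<comment> \<open>The instance with zeros, once simplified, says that \<open>omul 0 y\<close> is
      zero.\<close>
    by (simp add: omap_def qmap_def cmap_def oone_def zero_prod_def[symmetric] omul_scaleR_left[of 0 0, simplified])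
  show "omap n a b x \<bullet> omap n a b y = x \<bullet> y" for x y
    using inner_via_product omap_omul omap_ocnj omap_inner_oone by metis
qed

end

text \<open>Coordinates of \<open>\<complex>\<^sup>3\<close> on the orthogonal complement of \<open>\<complex>\<close>; the conjugations make right
  multiplication by \<open>\<complex>\<close> act as scalar multiplication.\<close>

definition oE1 :: "complex \<Rightarrow> oct" where "oE1 z = ((0, cnj z), (0, 0))"
definition oE2 :: "complex \<Rightarrow> oct" where "oE2 z = ((0, 0), (cnj z, 0))"
definition oE3 :: "complex \<Rightarrow> oct" where "oE3 z = ((0, 0), (0, z))"

lemmas oE_defs = oE1_def oE2_def oE3_def

lemma oE_ofC: "omul (oE1 z) (ofC t) = oE1 (z * t)" "omul (oE2 z) (ofC t) = oE2 (z * t)" "omul (oE3 z) (ofC t) = oE3 (z * t)"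
  by (simp_all add: oE_defs ofC_def oct_unfold)

lemma oE_omul: "omul (oE1 s) (oE2 t) = oE3 (cnj (s * t))" "omul (oE2 s) (oE3 t) = oE1 (cnj (s * t))"
   "omul (oE3 s) (oE1 t) = oE2 (cnj (s * t))" "omul (oE2 t) (oE1 s) = oE3 (- cnj (s * t))"
  by (simp_all add: oE_defs oct_unfold)

lemma oE_inner: "oE1 s \<bullet> oE2 t = 0" "oE2 s \<bullet> oE3 t = 0" "oE3 s \<bullet> oE1 t = 0"
  "oE2 t \<bullet> oE1 s = 0" "oE3 t \<bullet> oE2 s = 0" "oE1 t \<bullet> oE3 s = 0"
  by (simp_all add: oE_defs inner_prod_def)

lemma omap_values: "omap n a b (ofC \<i>) = n" "omap n a b (oE1 1) = a" "omap n a b (oE2 1) = b"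
  by (simp_all add: omap_def qmap_def cmap_def oE_defs ofC_def omul_scaleR_left[of 0 0, simplified])

lemma omap_fixes_ofC:
  assumes b: "basic_triple (ofC \<i>) a b"
  shows "omap (ofC \<i>) a b (ofC z) = ofC z"
proof -
  have z: "ofC z = Re z *\<^sub>R oone + Im z *\<^sub>R ofC \<i>"
    by (simp add: ofC_def oone_def prod_eq_iff complex_eq_iff)
  show ?thesis
    unfolding z using oaut_oone[OF omap_oaut[OF b]] linear_add[OF omap_linear[OF b]]
      linear_scale[OF omap_linear[OF b]] omap_values(1)[of "ofC \<i>" a b] by simp
qed

section \<open>Automorphisms fixing the scalars\<close>

locale scalars =
  fixes F A :: "oct set" and pr :: "oct \<Rightarrow> oct \<Rightarrow> oct"
  assumes cases: "F = Rset \<and> A = Hset \<and> pr = pairR \<or> F = Cset \<and> A = Oset \<and> pr = pairC"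
begin

lemma F_cases [case_names real complex]:
  assumes "F = Rset \<Longrightarrow> A = Hset \<Longrightarrow> pr = pairR \<Longrightarrow> P" "F = Cset \<Longrightarrow> A = Oset \<Longrightarrow> pr = pairC \<Longrightarrow> P"
  shows P
  using cases assms by blast

lemma F_subset_Cset: "F \<subseteq> Cset"
  by (rule F_cases) (auto simp: Rset_def Cset_def ofR_def)

lemma ofR_in_F: "ofR r \<in> F"
  by (rule F_cases) (auto simp: Rset_def Cset_def ofR_def)

lemma F_subset_A: "F \<subseteq> A"
  by (rule F_cases) (auto simp: Rset_def Hset_def Oset_def ofR_def ofC_def ofH_def)

lemma Hset_iff: "x \<in> Hset \<longleftrightarrow> snd x = 0"
  by (auto simp: Hset_def ofH_def image_iff prod_eq_iff)

lemma A_add: "x \<in> A \<Longrightarrow> y \<in> A \<Longrightarrow> x + y \<in> A"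
  by (rule F_cases) (auto simp: Hset_iff Oset_def)

lemma A_scaleR: "x \<in> A \<Longrightarrow> r *\<^sub>R x \<in> A"
  by (rule F_cases) (auto simp: Hset_iff Oset_def)

lemma A_omul: "x \<in> A \<Longrightarrow> y \<in> A \<Longrightarrow> omul x y \<in> A"
  by (rule F_cases) (auto simp: Hset_iff Oset_def oct_unfold zero_prod_def)

text \<open>Both forms are reduced to real orthogonality against the whole subspace
  \<open>xF\<close>, which makes most later arguments uniform in \<open>F\<close>.\<close>

lemma pr_eq_ozero_iff: "pr x y = ozero \<longleftrightarrow> (\<forall>t\<in>F. omul x t \<bullet> y = 0)"
proof (rule F_cases)
  assume "F = Rset" "pr = pairR"
  then show ?thesis by (auto simp: pairR_def Rset_def ofR_eq ipR_eq ozero_eq oone_neq_0 dest: spec[of _ 1])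
next
  assume "F = Cset" "pr = pairC"
  define c where "c = fst (fst (omul (ocnj x) y))"
  have "omul x (ofC t) \<bullet> y = t \<bullet> c" for t
    by (simp add: c_def inner_omul_left[of x]) (simp add: ofC_def inner_prod_def)
  moreover have "(\<forall>t. t \<bullet> c = 0) \<longleftrightarrow> c = 0"
    by (metis inner_eq_zero_iff inner_zero_right)
  ultimately show ?thesis
    using \<open>F = Cset\<close> \<open>pr = pairC\<close> by (auto simp: pairC_def Cset_def ozero_eq c_def[symmetric] ofC_def prod_eq_iff)
qed

lemma pr_eq_imp_inner_eq: "pr x y = pr x' y' \<Longrightarrow> x \<bullet> y = x' \<bullet> y'"
proof (rule F_cases)
  assume "pr = pairR" "pr x y = pr x' y'"
  then show ?thesis by (auto simp: pairR_def ofR_eq ipR_eq oone_def prod_eq_iff)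
next
  assume "pr = pairC" "pr x y = pr x' y'"
  then have "Re (fst (fst (omul (ocnj x) y))) = Re (fst (fst (omul (ocnj x') y')))"
    by (simp add: pairC_def ofC_def)
  then show ?thesis by (simp add: ipR_eq[symmetric] ipR_def ore_def)
qed

lemma Pu_iff: "x \<in> Pu F B \<longleftrightarrow> x \<in> B \<and> (\<forall>t\<in>F. t \<bullet> x = 0)"
  by (simp add: Pu_def ipR_eq)

text \<open>For \<open>F = Rset\<close> these are all automorphisms of the octonions, the compact
  group G2; for \<open>F = Cset\<close> they form a copy of SU(3).\<close>

definition faut :: "(oct \<Rightarrow> oct) \<Rightarrow> bool" where
  "faut g \<longleftrightarrow> oaut g \<and> (\<forall>t\<in>F. g t = t)"

lemma
  assumes "faut g"
  shows faut_add: "g (x + y) = g x + g y" and faut_diff: "g (x - y) = g x - g y"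
    and faut_scaleR: "g (r *\<^sub>R x) = r *\<^sub>R g x" and faut_minus: "g (- x) = - g x"
    and faut_omul: "g (omul x y) = omul (g x) (g y)" and faut_inner: "g x \<bullet> g y = x \<bullet> y"
    and faut_F: "t \<in> F \<Longrightarrow> g t = t" and faut_bij: "bij g"
  using assms oaut_linear[of g] linear_add[of g] linear_diff[of g] linear_scale[of g] linear_neg[of g]
    oaut_omul[of g] oaut_inner[of g] oaut_bij[of g]
  by (simp_all add: faut_def)

lemma faut_comp: "faut g \<Longrightarrow> faut h \<Longrightarrow> faut (g \<circ> h)"
  by (simp add: faut_def oaut_comp)

lemma faut_inv: "faut g \<Longrightarrow> faut (inv g)"
  by (metis faut_def faut_bij bij_inv_eq_iff oaut_inv)

text \<open>In the complex case the value is determined by the real numbers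
  \<open>omul x t \<bullet> y\<close> with \<open>t\<close> in \<open>F\<close>, and these are
  preserved since \<open>g\<close> fixes \<open>t\<close>.\<close>

lemma faut_pr: "faut g \<Longrightarrow> pr (g x) (g y) = pr x y"
proof (rule F_cases)
  assume "faut g" "pr = pairR"
  then show ?thesis by (simp add: pairR_def ipR_eq faut_inner)
next
  assume g: "faut g" and "pr = pairC" "F = Cset"
  define p where "p x y t = omul x (ofC t) \<bullet> y" for x y t
  have p: "p x y t = t \<bullet> fst (fst (omul (ocnj x) y))" for x y t
    by (simp add: p_def inner_omul_left[of x]) (simp add: ofC_def inner_prod_def)
  have "p (g x) (g y) t = p x y t" for t
  proof -
    have "g (ofC t) = ofC t" using faut_F[OF g] \<open>F = Cset\<close> by (simp add: Cset_def)
    then show ?thesis using faut_inner[OF g, of "omul x (ofC t)" y] faut_omul[OF g, of x "ofC t"] by (simp add: p_def)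
  qed
  then have "t \<bullet> fst (fst (omul (ocnj (g x)) (g y))) = t \<bullet> fst (fst (omul (ocnj x) y))" for t
    by (simp add: p)
  then have "fst (fst (omul (ocnj (g x)) (g y))) = fst (fst (omul (ocnj x) y))"
    by (metis vector_eq_ldot)
  then show ?thesis using \<open>pr = pairC\<close> by (simp add: pairC_def)
qed

lemma faut_Pu: "faut g \<Longrightarrow> x \<in> Pu F Oset \<Longrightarrow> g x \<in> Pu F Oset"
  unfolding Pu_iff by (metis Oset_def UNIV_I faut_F faut_inner)

section \<open>Orthonormal pairs and transitivity of the automorphisms on them\<close>

definition onb :: "oct set \<Rightarrow> oct \<Rightarrow> oct \<Rightarrow> bool" where
  "onb B x y \<longleftrightarrow> x \<in> Pu F B \<and> y \<in> Pu F B \<and> x \<bullet> x = 1 \<and> y \<bullet> y = 1 \<and> pr x y = ozero"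

lemma onb_Oset: "onb B x y \<Longrightarrow> onb Oset x y"
  by (auto simp: onb_def Pu_iff Oset_def)

lemma faut_onb: "faut g \<Longrightarrow> onb Oset x y \<Longrightarrow> onb Oset (g x) (g y)"
  by (simp add: onb_def faut_Pu faut_inner faut_pr)

lemma oone_in_F: "oone \<in> F"
  using ofR_in_F[of 1] by (simp add: ofR_eq)

lemma orthogonal_vector:
  assumes "length xs < 8"
  obtains w :: oct where "w \<bullet> w = 1" "\<forall>s\<in>set xs. w \<bullet> s = 0"
proof -
  have "dim (set xs) < DIM(oct)"
    using dim_le_card'[of "set xs"] card_length[of xs] assms by simp
  then obtain w where w: "w \<noteq> 0" "\<And>y. y \<in> span (set xs) \<Longrightarrow> orthogonal w y"
    using orthogonal_to_subspace_exists by blast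
  show thesis
  proof
    show "(w /\<^sub>R norm w) \<bullet> (w /\<^sub>R norm w) = 1"
      using w(1) by (simp add: dot_square_norm power2_eq_square)
    show "\<forall>s\<in>set xs. (w /\<^sub>R norm w) \<bullet> s = 0"
      using w(2) by (simp add: orthogonal_def span_base)
  qed
qed

text \<open>The pair is completed to a basic triple \<open>n, u, v\<close>. Over the reals
  \<open>n\<close> is any unit vector orthogonal to \<open>oone\<close>, \<open>u\<close>,
  \<open>v\<close> and \<open>uv\<close>; over the complex numbers it has to be
  \<open>ofC \<i>\<close>, and \<open>F\<close>-orthogonality of \<open>u\<close> and
  \<open>v\<close> supplies the last condition.\<close>

lemma faut_exists:
  assumes "onb Oset u v"
  obtains g where "faut g" "g (oE1 1) = u" "g (oE2 1) = v"
proof -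
  have uv: "u \<bullet> oone = 0" "v \<bullet> oone = 0" "u \<bullet> u = 1" "v \<bullet> v = 1" "\<And>t. t \<in> F \<Longrightarrow> omul u t \<bullet> v = 0"
    using assms oone_in_F by (auto simp: onb_def Pu_iff pr_eq_ozero_iff inner_commute)
  have uv0: "u \<bullet> v = 0" using uv(5)[OF oone_in_F] by simp
  have "\<exists>n. basic_triple n u v \<and> (\<forall>t\<in>F. omap n u v t = t)"
  proof (rule F_cases)
    assume "F = Rset"
    obtain n where "n \<bullet> n = 1" "\<forall>s\<in>set [oone, u, v, omul u v]. n \<bullet> s = 0"
      by (rule orthogonal_vector[of "[oone, u, v, omul u v]"]) simp
    then have n: "n \<bullet> n = 1" "n \<bullet> oone = 0" "n \<bullet> u = 0" "n \<bullet> v = 0" "n \<bullet> omul u v = 0"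
      by simp_all
    \<comment> \<open>Taking \<open>u\<close> to the other side of the inner product turns the
      condition on \<open>nu\<close> and \<open>v\<close> into orthogonality of \<open>n\<close> and
      \<open>uv\<close>.\<close>
    have "omul u v = - omul v u"
      using imaginary_anticommute uv uv0 by blast
    then have "v \<bullet> omul n u = 0"
      using inner_omul_right[of n u v] uv n by (simp add: imaginary_cnj inner_commute)
    then have b: "basic_triple n u v" using n uv uv0 by (simp add: basic_triple_def inner_commute)
    moreover have "\<forall>t\<in>F. omap n u v t = t"
      using oaut_oone[OF omap_oaut[OF b]] linear_scale[OF omap_linear[OF b]] \<open>F = Rset\<close> by (auto simp: Rset_def ofR_eq)
    ultimately show ?thesis by blast
  next
    assume "F = Cset"
    define n where "n = ofC \<i>"
    have nF: "n \<in> F" using \<open>F = Cset\<close> by (simp add: n_def Cset_def)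
    have n: "n \<bullet> oone = 0" "n \<bullet> n = 1" by (simp_all add: n_def ofC_def oone_def inner_prod_def inner_complex_def)
    have nu: "u \<bullet> n = 0" "v \<bullet> n = 0" using assms nF by (simp_all add: onb_def Pu_iff inner_commute)
    have "omul n u = - omul u n"
      using imaginary_anticommute n nu uv by (metis inner_commute)
    then have b: "basic_triple n u v" using n nu uv uv0 uv(5)[OF nF] by (simp add: basic_triple_def inner_commute)
    have "\<forall>t\<in>F. omap n u v t = t"
      using omap_fixes_ofC b \<open>F = Cset\<close> by (auto simp: Cset_def n_def)
    then show ?thesis using b by blast
  qed
  then obtain n where "basic_triple n u v" "\<forall>t\<in>F. omap n u v t = t" by blast
  then show thesis using that[of "omap n u v"] omap_values omap_oaut by (simp add: faut_def)
qed

end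

text \<open>Octonions are nested pairs, and these rules would break up every quantified octonion
  into components.\<close>

declare split_paired_All [simp del] split_paired_Ex [simp del]

context scalars
begin

section \<open>The geometry\<close>

abbreviation "GV \<equiv> Gelems F A pr"
abbreviation "GI \<equiv> Gincid F pr"

abbreviation pt :: "oct \<Rightarrow> elem" where "pt x \<equiv> Pt (opoint F x)"

definition Gpoints where "Gpoints = {pt x | x. x \<in> Pu F A \<and> x \<noteq> 0}"
definition Glines where
  "Glines = {Ln (oline F x u) | x u. x \<in> Pu F A \<and> u \<in> Pu F Oset \<and> x \<bullet> x = u \<bullet> u \<and> x \<noteq> 0}"
definition Gplanes where "Gplanes = {Pl s | s. sharp F A pr s}"

lemma Pu_scaleR: "x \<in> Pu F A \<Longrightarrow> r *\<^sub>R x \<in> Pu F A"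
  "x \<in> Pu F Oset \<Longrightarrow> r *\<^sub>R x \<in> Pu F Oset"
  by (auto simp: Pu_iff Oset_def A_scaleR)

lemma Pu_add: "x \<in> Pu F A \<Longrightarrow> y \<in> Pu F A \<Longrightarrow> x + y \<in> Pu F A"
  "x \<in> Pu F Oset \<Longrightarrow> y \<in> Pu F Oset \<Longrightarrow> x + y \<in> Pu F Oset"
  by (auto simp: Pu_iff Oset_def A_add inner_add_right)

lemma pr_scaleR: "pr x y = ozero \<Longrightarrow> pr (r *\<^sub>R x) (s *\<^sub>R y) = ozero"
  by (simp add: pr_eq_ozero_iff)

lemma pr_add: "pr x y = ozero \<Longrightarrow> pr x z = ozero \<Longrightarrow> pr x (y + z) = ozero"
  "pr x z = ozero \<Longrightarrow> pr y z = ozero \<Longrightarrow> pr (x + y) z = ozero"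
  by (simp_all add: pr_eq_ozero_iff inner_simps omul_distribs)

lemma Pu_diff: "x \<in> Pu F A \<Longrightarrow> y \<in> Pu F A \<Longrightarrow> x - y \<in> Pu F A"
  "x \<in> Pu F Oset \<Longrightarrow> y \<in> Pu F Oset \<Longrightarrow> x - y \<in> Pu F Oset"
  using Pu_add[of x "(-1) *\<^sub>R y"] Pu_scaleR[of y "-1"] by simp_all

lemma pr_diff: "pr x y = ozero \<Longrightarrow> pr x z = ozero \<Longrightarrow> pr x (y - z) = ozero"
  by (simp add: pr_eq_ozero_iff inner_simps)

lemma F_ocnj: "t \<in> F \<Longrightarrow> ocnj t \<in> F"
proof (rule F_cases)
  have "ocnj (ofC z) = ofC (cnj z)" for z by (simp add: ofC_def oct_unfold)
  then show "t \<in> F \<Longrightarrow> F = Rset \<Longrightarrow> ?thesis" "t \<in> F \<Longrightarrow> F = Cset \<Longrightarrow> ?thesis"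
    by (auto simp: Rset_def Cset_def ofR_def)
qed

lemma pr_sym: "pr x y = ozero \<Longrightarrow> pr y x = ozero"
  unfolding pr_eq_ozero_iff by (metis F_ocnj inner_commute inner_omul_right ocnj_ocnj)

lemma pr_imp_orthogonal: "pr x y = ozero \<Longrightarrow> x \<bullet> y = 0"
  using oone_in_F by (auto simp: pr_eq_ozero_iff)

text \<open>A dimension count in the real space of dimension 8: there are seven real conditions over
  the reals, four of them forcing \<open>r\<close> into \<open>Hset\<close>, and six over the
  complex numbers. The vector is always taken in \<open>A\<close>, which serves both choices of
  \<open>B\<close>.\<close>

lemma perpendicular_exists:
  assumes "B = A \<or> B = Oset"
  obtains r where "r \<in> Pu F B" "r \<bullet> r = 1" "pr x r = ozero" "pr y r = ozero"
proof -
  have "\<exists>r. r \<in> A \<and> r \<bullet> r = 1 \<and> (\<forall>t\<in>F. t \<bullet> r = 0 \<and> omul x t \<bullet> r = 0 \<and> omul y t \<bullet> r = 0)"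
  proof (rule F_cases)
    assume c: "F = Rset" "A = Hset"
    obtain r where r: "r \<bullet> r = 1"
        "\<forall>s\<in>set [oone, x, y, (0,(1,0)), (0,(\<i>,0)), (0,(0,1)), (0,(0,\<i>))]. r \<bullet> s = 0"
      by (rule orthogonal_vector[of "[oone, x, y, (0,(1,0)), (0,(\<i>,0)), (0,(0,1)), (0,(0,\<i>))]"]) simp
    then have r1: "r \<bullet> oone = 0" "r \<bullet> x = 0" "r \<bullet> y = 0" by simp_all
    have "r \<in> Hset"
      using r(2) by (cases r) (auto simp: Hset_iff inner_complex_def prod_eq_iff complex_eq_iff)
    moreover have "t \<bullet> r = 0" "omul x t \<bullet> r = 0" "omul y t \<bullet> r = 0" if "t \<in> F" for t
      using r1 that c by (auto simp: Rset_def ofR_eq inner_commute)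
    ultimately show "\<exists>r. r \<in> A \<and> r \<bullet> r = 1 \<and> (\<forall>t\<in>F. t \<bullet> r = 0 \<and> omul x t \<bullet> r = 0 \<and> omul y t \<bullet> r = 0)"
      using c r(1) by blast
  next
    assume c: "F = Cset" "A = Oset"
    let ?i = "ofC \<i>"
    obtain r where r: "r \<bullet> r = 1" "\<forall>s\<in>set [oone, ?i, x, omul x ?i, y, omul y ?i]. r \<bullet> s = 0"
      by (rule orthogonal_vector[of "[oone, ?i, x, omul x ?i, y, omul y ?i]"]) simp
    then have r1: "r \<bullet> oone = 0" "r \<bullet> ?i = 0" "r \<bullet> x = 0" "r \<bullet> omul x ?i = 0" "r \<bullet> y = 0" "r \<bullet> omul y ?i = 0"
      by simp_all
    have z: "ofC z = Re z *\<^sub>R oone + Im z *\<^sub>R ?i" for z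
      by (simp add: ofC_def oone_def prod_eq_iff complex_eq_iff)
    have "t \<bullet> r = 0" "omul x t \<bullet> r = 0" "omul y t \<bullet> r = 0" if t: "t \<in> F" for t
    proof -
      obtain w where "t = ofC w" using t c by (auto simp: Cset_def)
      then have t': "t = Re w *\<^sub>R oone + Im w *\<^sub>R ?i" using z[of w] by metis
      show "t \<bullet> r = 0" "omul x t \<bullet> r = 0" "omul y t \<bullet> r = 0"
        unfolding t' using r1 by (simp_all add: omul_distribs inner_simps inner_commute)
    qed
    then show "\<exists>r. r \<in> A \<and> r \<bullet> r = 1 \<and> (\<forall>t\<in>F. t \<bullet> r = 0 \<and> omul x t \<bullet> r = 0 \<and> omul y t \<bullet> r = 0)"
      using c r(1) Oset_def by blast
  qed
  then obtain r where "r \<in> A" "r \<bullet> r = 1" "\<forall>t\<in>F. t \<bullet> r = 0" "\<forall>t\<in>F. omul x t \<bullet> r = 0" "\<forall>t\<in>F. omul y t \<bullet> r = 0"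
    by blast
  then show thesis
    using that[of r] assms unfolding Pu_iff pr_eq_ozero_iff by (metis Oset_def UNIV_I)
qed

lemma onb_sym: "onb B x y \<Longrightarrow> onb B y x"
  by (auto simp: onb_def intro: pr_sym)

section \<open>Planes as restrictions of automorphisms\<close>

definition plane :: "(oct \<Rightarrow> oct) \<Rightarrow> oct \<Rightarrow> oct" where
  "plane g x = (if x \<in> A then g x else ozero)"

lemma sharp_plane: "faut g \<Longrightarrow> sharp F A pr (plane g)"
  using F_subset_A
  by (auto simp: sharp_def plane_def oadd_eq A_add A_omul faut_add faut_omul faut_F faut_pr subset_iff
      simp del: split_paired_All)

lemma faut_exists2:
  assumes "onb Oset x y" "onb Oset u v"
  obtains g where "faut g" "g x = u" "g y = v"
proof -
  obtain g h where g: "faut g" "g (oE1 1) = x" "g (oE2 1) = y" and h: "faut h" "h (oE1 1) = u" "h (oE2 1) = v"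
    using assms faut_exists by metis
  have "inv g x = oE1 1" "inv g y = oE2 1" using g faut_bij by (auto simp: bij_is_inj inv_f_eq)
  then show thesis using that[of "h \<circ> inv g"] g h by (simp add: faut_comp faut_inv)
qed

lemma plane_exists:
  assumes "onb A x y" "onb Oset u v"
  obtains s where "sharp F A pr s" "s x = u" "s y = v" "s (omul x y) = omul u v"
    "\<And>a b. s (a *\<^sub>R x + b *\<^sub>R y) = a *\<^sub>R u + b *\<^sub>R v"
proof -
  obtain g where g: "faut g" "g x = u" "g y = v"
    using faut_exists2 assms onb_Oset by metis
  have xy: "x \<in> A" "y \<in> A" using assms by (auto simp: onb_def Pu_iff)
  show thesis
    by (rule that[OF sharp_plane[OF g(1)]])
      (use g xy in \<open>auto simp: plane_def A_omul A_add A_scaleR faut_omul faut_add faut_scaleR\<close>)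
qed

text \<open>The image of \<open>oone\<close> is an idempotent of norm one, and cancelling one factor
  by \<open>left_alternative\<close> leaves \<open>oone\<close>; linearity over \<open>F\<close>
  does the rest.\<close>

lemma sharp_fixes_F:
  assumes s: "sharp F A pr s" and t: "t \<in> F"
  shows "s t = t"
proof -
  have o: "oone \<in> A" using oone_in_F F_subset_A by blast
  have "s oone \<bullet> s oone = 1"
    using s o pr_eq_imp_inner_eq[of "s oone" "s oone" oone oone] by (auto simp: sharp_def)
  moreover have "omul (s oone) (s oone) = s oone"
    using s o unfolding sharp_def by (metis omul_oone(1))
  ultimately have "s oone = oone"
    using left_alternative[of "s oone" oone] left_alternative[of "s oone" "s oone"] by simp
  then show ?thesis using s o t unfolding sharp_def by (metis omul_oone(1))
qed

lemma sharp_inner: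
  assumes "sharp F A pr s" "x \<in> A" "y \<in> A"
  shows "s x \<bullet> s y = x \<bullet> y"
  using assms by (intro pr_eq_imp_inner_eq) (simp add: sharp_def)

lemma sharp_Pu:
  assumes "sharp F A pr s" "x \<in> Pu F A"
  shows "s x \<in> Pu F Oset"
  using assms sharp_inner[OF assms(1), of _ x] sharp_fixes_F[OF assms(1)] F_subset_A
  unfolding Pu_iff Oset_def by fastforce

lemma opoint_scaleR: "r \<noteq> 0 \<Longrightarrow> opoint F (r *\<^sub>R x) = opoint F x"
proof -
  have *: "r *\<^sub>R t \<in> F" if "t \<in> F" for r t
    using that by (rule_tac F_cases)
      (auto simp: Rset_def Cset_def ofR_eq ofC_def image_iff prod_eq_iff)
  have "opoint F (r *\<^sub>R x) \<subseteq> opoint F x" for r x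
  proof
    fix y assume "y \<in> opoint F (r *\<^sub>R x)"
    then obtain t where "t \<in> F" "y = omul (r *\<^sub>R x) t" unfolding opoint_def by blast
    then have "y = omul x (r *\<^sub>R t)" "r *\<^sub>R t \<in> F" using * by simp_all
    then show "y \<in> opoint F x" unfolding opoint_def by blast
  qed
  from this[of r x] this[of "inverse r" "r *\<^sub>R x"] show "r \<noteq> 0 \<Longrightarrow> ?thesis" by simp
qed

lemma unit_scaleR: "x \<noteq> 0 \<Longrightarrow> ((1 / norm x) *\<^sub>R x) \<bullet> ((1 / norm x) *\<^sub>R x) = 1" for x :: oct
  by (simp add: dot_square_norm power2_eq_square)

lemma point_mem: "x \<in> Pu F A \<Longrightarrow> x \<noteq> 0 \<Longrightarrow> pt x \<in> Gpoints"
  unfolding Gpoints_def by blast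

lemma plane_mem: "sharp F A pr s \<Longrightarrow> Pl s \<in> Gplanes"
  unfolding Gplanes_def by blast

lemma incident_point_line: "pr x y = ozero \<Longrightarrow> GI (pt y) (Ln (oline F x u))"
  unfolding Gincid_def incid0.simps by blast

lemma incident_plane_line: "s x = u \<Longrightarrow> GI (Pl s) (Ln (oline F x u))"
  unfolding Gincid_def incid0.simps by blast

lemma unit_nonzero: "x \<bullet> x = 1 \<Longrightarrow> x \<noteq> 0" for x :: oct
  by auto

sublocale flat_geometry GV GI Gpoints Glines Gplanes
proof
  show "GI a a" for a by (simp add: Gincid_def)
  show "GI a b \<Longrightarrow> GI b a" for a b by (auto simp: Gincid_def)
  show "GV = Gpoints \<union> Glines \<union> Gplanes"
    by (simp add: Gelems_def Gpoints_def Glines_def Gplanes_def ozero_eq onorm2_def ipR_eq)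
  show "p \<in> Gpoints \<Longrightarrow> s \<in> Gplanes \<Longrightarrow> GI p s" for p s
    by (auto simp: Gpoints_def Gplanes_def Gincid_def)
  show "a = b" if "GI a b" "a \<in> Gpoints \<and> b \<in> Gpoints \<or> a \<in> Glines \<and> b \<in> Glines \<or> a \<in> Gplanes \<and> b \<in> Gplanes" for a b
    using that by (auto simp: Gpoints_def Glines_def Gplanes_def Gincid_def)
  show "\<exists>p\<in>Gpoints. GI p l" if "l \<in> Glines" for l
  proof -
    obtain x u where l: "l = Ln (oline F x u)" using \<open>l \<in> Glines\<close> by (auto simp: Glines_def)
    obtain r where r: "r \<in> Pu F A" "r \<bullet> r = 1" "pr x r = ozero"
      using perpendicular_exists[of A x x] by blast
    then show ?thesis
      using point_mem unit_nonzero incident_point_line l by blast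
  qed
  show "\<exists>s\<in>Gplanes. GI s l" if "l \<in> Glines" for l
  proof -
    obtain x u where l: "l = Ln (oline F x u)" "x \<in> Pu F A" "u \<in> Pu F Oset" "x \<bullet> x = u \<bullet> u" "x \<noteq> 0"
      using \<open>l \<in> Glines\<close> by (auto simp: Glines_def)
    have n: "norm x = norm u" using l by (simp add: norm_eq_sqrt_inner)
    \<comment> \<open>\<open>plane_exists\<close> wants unit vectors; as \<open>x\<close> and
      \<open>u\<close> have the same norm, one factor normalises both.\<close>
    define c where "c = 1 / norm x"
    have c: "c \<noteq> 0" using l by (simp add: c_def)
    obtain y where y: "y \<in> Pu F A" "y \<bullet> y = 1" "pr x y = ozero"
      using perpendicular_exists[of A x x] by blast
    obtain v where v: "v \<in> Pu F Oset" "v \<bullet> v = 1" "pr u v = ozero"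
      using perpendicular_exists[of Oset u u] by blast
    have "u \<noteq> 0" using l n by auto
    then have cc: "(c *\<^sub>R x) \<bullet> (c *\<^sub>R x) = 1" "(c *\<^sub>R u) \<bullet> (c *\<^sub>R u) = 1"
      using unit_scaleR l c_def n by metis+
    have "onb A (c *\<^sub>R x) y"
      unfolding onb_def using l y pr_scaleR[of x y c 1] cc Pu_scaleR by simp
    moreover have "onb Oset (c *\<^sub>R u) v"
      unfolding onb_def using l v pr_scaleR[of u v c 1] cc Pu_scaleR by simp
    ultimately obtain s where s: "sharp F A pr s" "\<And>a b. s (a *\<^sub>R c *\<^sub>R x + b *\<^sub>R y) = a *\<^sub>R c *\<^sub>R u + b *\<^sub>R v"
      using plane_exists by metis
    have "s x = u" using s(2)[of "1/c" 0] c by simp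
    then show ?thesis
      using s(1) plane_mem incident_plane_line l(1) by blast
  qed
qed

abbreviation ghtp (infix "\<simeq>" 50) where "p \<simeq> q \<equiv> homotopic GV GI p q"

lemma square_null:
  assumes "p \<in> Pu F A" "q \<in> Pu F A" "z \<in> Pu F A" "p \<noteq> 0" "q \<noteq> 0" "z \<noteq> 0"
    "sharp F A pr s" "sharp F A pr t" "s z = t z" "pr z p = ozero" "pr z q = ozero"
  shows "[pt p, Pl s, pt q] \<simeq> [pt p, Pl t, pt q]" "[Pl s, pt p, Pl t] \<simeq> [Pl s, pt q, Pl t]"
proof -
  define l where "l = Ln (oline F z (s z))"
  have "pt p \<in> Gpoints" "pt q \<in> Gpoints" "Pl s \<in> Gplanes" "Pl t \<in> Gplanes"
    using assms point_mem plane_mem by blast+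
  moreover have "l \<in> Glines"
  proof -
    have "z \<in> A" using assms by (simp add: Pu_iff)
    then show ?thesis
      using assms(3,6,7) sharp_Pu[of s z] sharp_inner[of s z z] unfolding Glines_def l_def by force
  qed
  moreover have "GI (pt p) l" "GI (pt q) l" "GI (Pl s) l" "GI (Pl t) l"
    using assms incident_point_line incident_plane_line unfolding l_def by metis+
  ultimately show "[pt p, Pl s, pt q] \<simeq> [pt p, Pl t, pt q]" "[Pl s, pt p, Pl t] \<simeq> [Pl s, pt q, Pl t]"
    by (auto intro!: htp_via_common[where l=l] simp: flat flat') (auto simp: V_eq)
qed

section \<open>Frames\<close>

lemma ofC_inner_oE: "ofC t \<bullet> oE1 z = 0" "ofC t \<bullet> oE2 z = 0" "ofC t \<bullet> oE3 z = 0"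
  by (simp_all add: ofC_def oE_defs inner_prod_def)

lemma F_cases_ofC: "t \<in> F \<Longrightarrow> \<exists>z. t = ofC z"
  using F_subset_Cset by (auto simp: Cset_def)

lemma oE_Pu: "oE1 z \<in> Pu F Oset" "oE2 z \<in> Pu F Oset" "oE3 z \<in> Pu F Oset"
  by (auto simp: Pu_iff Oset_def ofC_inner_oE dest!: F_cases_ofC)

lemma oE_pr:
  "pr (oE1 s) (oE2 t) = ozero" "pr (oE2 s) (oE3 t) = ozero" "pr (oE3 s) (oE1 t) = ozero"
  "pr (oE2 s) (oE1 t) = ozero" "pr (oE3 s) (oE2 t) = ozero" "pr (oE1 s) (oE3 t) = ozero"
  by (auto simp: pr_eq_ozero_iff oE_ofC oE_inner dest!: F_cases_ofC)

lemma oE_norm: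
  assumes "cmod z = 1"
  shows "oE1 z \<bullet> oE1 z = 1" "oE2 z \<bullet> oE2 z = 1" "oE3 z \<bullet> oE3 z = 1"
  using assms by (simp_all add: oE_defs inner_prod_def dot_square_norm)

lemma oE_onb:
  assumes "cmod s = 1" "cmod t = 1"
  shows "onb Oset (oE1 s) (oE2 t)" "onb Oset (oE2 s) (oE3 t)" "onb Oset (oE3 s) (oE1 t)"
  using oE_norm assms by (simp_all add: onb_def oE_Pu oE_pr)

text \<open>An automorphism moves the standard vectors \<open>oE1 1\<close>, \<open>oE2 1\<close>,
  \<open>oE3 1\<close> to \<open>x\<close>, \<open>y\<close>, \<open>xy\<close>, so the cyclic
  relations only have to be computed for the former.\<close>

lemma onb_omul:
  assumes "onb B x y" "B = A \<or> B = Oset"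
  shows "onb B y (omul x y)" "onb B (omul x y) x" "omul (omul x y) x = y" "omul y (omul x y) = x"
    "omul y x = - omul x y"
proof -
  obtain g where g: "faut g" "g (oE1 1) = x" "g (oE2 1) = y"
    using faut_exists onb_Oset[OF assms(1)] by metis
  have xy: "omul x y = g (oE3 1)" using g faut_omul[OF g(1), of "oE1 1" "oE2 1"] by (simp add: oE_omul)
  have B: "omul x y \<in> B" "x \<in> B" "y \<in> B" using assms A_omul unfolding onb_def Pu_iff Oset_def by blast+
  have "onb Oset (g (oE2 1)) (g (oE3 1))" "onb Oset (g (oE3 1)) (g (oE1 1))"
    using faut_onb[OF g(1)] oE_onb by simp_all
  then show "onb B y (omul x y)" "onb B (omul x y) x"
    using B unfolding xy[symmetric] g onb_def Pu_iff by blast+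
  show "omul (omul x y) x = y" "omul y (omul x y) = x"
    unfolding xy using g faut_omul[OF g(1)] by (metis oE_omul complex_cnj_one mult_1)+
  show "omul y x = - omul x y"
    using assms(1) oone_in_F pr_imp_orthogonal[of x y]
    by (intro imaginary_anticommute) (auto simp: onb_def Pu_iff inner_commute)
qed

lemma onb_nonzero: "onb B x y \<Longrightarrow> x \<noteq> 0 \<and> y \<noteq> 0"
  by (auto simp: onb_def)

lemma onb_pr: "onb B x y \<Longrightarrow> pr x y = ozero"
  by (simp add: onb_def)

lemma onb_Pu: "onb B x y \<Longrightarrow> x \<in> Pu F B \<and> y \<in> Pu F B"
  by (simp add: onb_def)

lemma onb_pr_sum_diff:
  assumes "onb B x y"
  shows "pr (x + y) (x - y) = ozero"
proof -
  obtain g where g: "faut g" "g (oE1 1) = x" "g (oE2 1) = y"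
    using faut_exists onb_Oset[OF assms] by metis
  have "pr (oE1 1 + oE2 1) (oE1 1 - oE2 1) = ozero"
  proof -
    have "omul (oE1 1 + oE2 1) (ofC z) \<bullet> (oE1 1 - oE2 1) = 0" for z
      by (simp add: omul_add_left oE_ofC) (simp add: oE_defs inner_prod_def inner_complex_def)
    then show ?thesis unfolding pr_eq_ozero_iff using F_cases_ofC by metis
  qed
  then show ?thesis
    using faut_pr[OF g(1), of "oE1 1 + oE2 1" "oE1 1 - oE2 1"] g by (simp add: faut_add faut_diff)
qed

section \<open>Loops and the exchange of values\<close>

abbreviation loop_at :: "oct \<Rightarrow> oct \<Rightarrow> (oct \<Rightarrow> oct) \<Rightarrow> (oct \<Rightarrow> oct) \<Rightarrow> elem list" where
  "loop_at r q s' s \<equiv> [pt r, Pl s', pt q, Pl s, pt r]"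

text \<open>The homotopy class of the loop depends only on \<open>s' x\<close> and \<open>s x\<close>,
  because \<open>x\<close> is orthogonal to \<open>xy\<close> and \<open>y\<close>.\<close>

definition loops_agree :: "oct \<Rightarrow> oct \<Rightarrow> oct \<times> oct \<Rightarrow> oct \<times> oct \<Rightarrow> bool" where
  "loops_agree x y p q \<longleftrightarrow> (\<forall>s s' t t'. sharp F A pr s \<longrightarrow> sharp F A pr s' \<longrightarrow> sharp F A pr t \<longrightarrow> sharp F A pr t' \<longrightarrow>
     (s' x, s x) = p \<longrightarrow> (t' x, t x) = q \<longrightarrow>
     loop_at (omul x y) y s' s \<simeq> loop_at (omul x y) y t' t)"

lemma loop_at_cong:
  assumes "sharp F A pr s" "sharp F A pr s'" "sharp F A pr t" "sharp F A pr t'"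
    and "r \<in> Pu F A" "q \<in> Pu F A" "z \<in> Pu F A" "r \<noteq> 0" "q \<noteq> 0" "z \<noteq> 0" "pr z r = ozero" "pr z q = ozero"
    and "s z = t z" "s' z = t' z"
  shows "loop_at r q s' s \<simeq> loop_at r q t' t"
  by (rule loop_cong) (use assms in \<open>auto intro!: square_null[where z=z] point_mem plane_mem\<close>)

lemma loop_at_swap:
  assumes "sharp F A pr s" "sharp F A pr s'"
    and "r \<in> Pu F A" "q \<in> Pu F A" "p \<in> Pu F A" "z \<in> Pu F A" "r \<noteq> 0" "q \<noteq> 0" "p \<noteq> 0" "z \<noteq> 0"
    and "pr z p = ozero" "pr z q = ozero" "s z = s' z"
  shows "loop_at r q s' s \<simeq> loop_at r p s' s"
  by (rule loop_swap_point) (use assms in \<open>auto intro!: square_null[where z=z] point_mem plane_mem\<close>)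

text \<open>The middle point \<open>y\<close> is traded for \<open>p = x - y\<close> and later
  traded back, each time along \<open>r = xy\<close>, where the two planes of the loop agree by
  \<open>uv\<close>. In between, the planes are replaced by ones agreeing with them at
  \<open>w = x + y\<close>.\<close>

lemma loops_agree_swap:
  assumes x: "onb A x y" and u: "onb Oset u v" "onb Oset u' v'" and uv: "omul u v = omul u' v'"
  shows "loops_agree x y (u', u) (v', v)"
  unfolding loops_agree_def
proof (intro allI impI)
  fix s s' t t'
  assume sharp: "sharp F A pr s" "sharp F A pr s'" "sharp F A pr t" "sharp F A pr t'"
    and st: "(s' x, s x) = (u', u)" "(t' x, t x) = (v', v)"
  define r where "r = omul x y"
  obtain a where a: "sharp F A pr a" "a x = u" "a y = v" "a r = omul u v" "\<And>c d. a (c *\<^sub>R x + d *\<^sub>R y) = c *\<^sub>R u + d *\<^sub>R v"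
    using plane_exists[OF x u(1)] r_def by metis
  obtain a' where a': "sharp F A pr a'" "a' x = u'" "a' y = v'" "a' r = omul u' v'" "\<And>c d. a' (c *\<^sub>R x + d *\<^sub>R y) = c *\<^sub>R u' + d *\<^sub>R v'"
    using plane_exists[OF x u(2)] r_def by metis
  \<comment> \<open>Exchanging the values at \<open>x\<close> and \<open>y\<close> keeps the value
    at \<open>x + y\<close> and turns the value at \<open>x\<close> from \<open>u\<close> into
    \<open>v\<close>.\<close>
  obtain b where b: "sharp F A pr b" "b x = v" "b y = u" "b r = omul v u" "\<And>c d. b (c *\<^sub>R x + d *\<^sub>R y) = c *\<^sub>R v + d *\<^sub>R u"
    using plane_exists[OF x onb_sym[OF u(1)]] r_def by metis
  obtain b' where b': "sharp F A pr b'" "b' x = v'" "b' y = u'" "b' r = omul v' u'" "\<And>c d. b' (c *\<^sub>R x + d *\<^sub>R y) = c *\<^sub>R v' + d *\<^sub>R u'"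
    using plane_exists[OF x onb_sym[OF u(2)]] r_def by metis
  have onb: "onb A y r" "onb A r x" using onb_omul[OF x] by (simp_all add: r_def)
  have Pu: "x \<in> Pu F A" "y \<in> Pu F A" "r \<in> Pu F A" "x \<noteq> 0" "y \<noteq> 0" "r \<noteq> 0"
    using onb_Pu onb_nonzero x onb by blast+
  have pr: "pr x y = ozero" "pr x r = ozero" "pr y r = ozero" "pr r x = ozero" "pr r y = ozero"
    using onb_pr pr_sym x onb by blast+
  define w p where "w = x + y" and "p = x - y"
  have wp: "w \<in> Pu F A" "p \<in> Pu F A" using Pu Pu_add Pu_diff by (simp_all add: w_def p_def)
  have "x \<bullet> x = 1" "x \<bullet> y = 0" using x pr_imp_orthogonal[OF pr(1)] by (simp_all add: onb_def)
  then have "x \<bullet> w = 1" "x \<bullet> p = 1" by (simp_all add: w_def p_def inner_simps)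
  then have nz: "w \<noteq> 0" "p \<noteq> 0" by auto
  have prw: "pr w p = ozero" "pr w r = ozero" "pr r p = ozero"
    using onb_pr_sum_diff[OF x] pr_add pr_diff pr by (simp_all add: w_def p_def)
  have "a w = b w" "a' w = b' w"
    using a(5)[of 1 1] b(5)[of 1 1] a'(5)[of 1 1] b'(5)[of 1 1] by (simp_all add: w_def add.commute)
  have "a r = a' r" using a a' uv by simp
  have "b r = b' r" using b b' uv onb_omul(5)[OF u(1)] onb_omul(5)[OF u(2)] by simp
  have "loop_at r y s' s \<simeq> loop_at r y a' a"
    by (rule loop_at_cong[where z=x]) (use sharp st a a' Pu pr in auto)
  also have "loop_at r y a' a \<simeq> loop_at r p a' a"
    by (rule loop_at_swap[where z=r]) (use a a' Pu pr wp nz prw \<open>a r = a' r\<close> in auto)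
  also have "loop_at r p a' a \<simeq> loop_at r p b' b"
    by (rule loop_at_cong[where z=w]) (use a a' b b' Pu wp nz prw \<open>a w = b w\<close> \<open>a' w = b' w\<close> in auto)
  also have "loop_at r p b' b \<simeq> loop_at r y b' b"
    by (rule loop_at_swap[where z=r]) (use b b' Pu pr wp nz prw \<open>b r = b' r\<close> in auto)
  also have "loop_at r y b' b \<simeq> loop_at r y t' t"
    by (rule loop_at_cong[where z=x]) (use sharp st b b' Pu pr in auto)
  finally show "loop_at (omul x y) y s' s \<simeq> loop_at (omul x y) y t' t" by (simp add: r_def)
qed

lemma plane_through:
  assumes "onb A x y" "u \<in> Pu F Oset" "u \<bullet> u = 1"
  obtains s where "sharp F A pr s" "s x = u"
proof -
  obtain v where "v \<in> Pu F Oset" "v \<bullet> v = 1" "pr u v = ozero"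
    using perpendicular_exists[of Oset u u] by blast
  then have "onb Oset u v" using assms by (simp add: onb_def)
  then show thesis using plane_exists[OF assms(1)] that by metis
qed

text \<open>The middle values must be attained by actual planes; the hypotheses on \<open>u\<close>
  and \<open>u'\<close> ensure this.\<close>

lemma loops_agree_trans:
  assumes x: "onb A x y" and l: "loops_agree x y p (u', u)" "loops_agree x y (u', u) q"
    and u: "u \<in> Pu F Oset" "u \<bullet> u = 1" "u' \<in> Pu F Oset" "u' \<bullet> u' = 1"
  shows "loops_agree x y p q"
proof -
  obtain c where c: "sharp F A pr c" "c x = u"
    by (rule plane_through[OF x u(1,2)])
  obtain c' where c': "sharp F A pr c'" "c' x = u'"
    by (rule plane_through[OF x u(3,4)])
  show ?thesis
    unfolding loops_agree_def
  proof (intro allI impI)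
    fix s s' t t'
    assume st: "sharp F A pr s" "sharp F A pr s'" "sharp F A pr t" "sharp F A pr t'" "(s' x, s x) = p" "(t' x, t x) = q"
    have "loop_at (omul x y) y s' s \<simeq> loop_at (omul x y) y c' c"
      using l(1) st c c' unfolding loops_agree_def by simp
    also have "loop_at (omul x y) y c' c \<simeq> loop_at (omul x y) y t' t"
      using l(2) st c c' unfolding loops_agree_def by simp
    finally show "loop_at (omul x y) y s' s \<simeq> loop_at (omul x y) y t' t" .
  qed
qed

abbreviation square :: "oct \<Rightarrow> oct \<Rightarrow> (oct \<Rightarrow> oct) \<Rightarrow> (oct \<Rightarrow> oct) \<Rightarrow> bool" where
  "square r q s t \<equiv> [pt r, Pl s, pt q] \<simeq> [pt r, Pl t, pt q]"

section \<open>Null-homotopic squares\<close>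

text \<open>With \<open>e\<^sub>1, e\<^sub>2, e\<^sub>3\<close> a frame of \<open>\<complex>\<^sup>3\<close> the loops of \<open>(e\<^sub>1 l, e\<^sub>1)\<close>, \<open>(e\<^sub>2 l\<^sup>*, e\<^sub>2)\<close>, \<open>(e\<^sub>3 l, e\<^sub>3)\<close> and
  \<open>(e\<^sub>1 l\<^sup>*, e\<^sub>1)\<close> agree: the number of steps around the frame is odd.\<close>

lemma square_conjugate_phases:
  assumes x: "onb A x y" and g: "faut g" and l: "cmod l = 1"
    and s: "sharp F A pr s" "s x = g (oE1 l)" and t: "sharp F A pr t" "t x = g (oE1 (cnj l))"
  shows "square (omul x y) y s t"
proof -
  have lc: "l * cnj l = 1" "cnj l * l = 1" using l by (simp_all add: complex_norm_square[symmetric] mult.commute)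
  have c: "cmod (cnj l) = 1" "cmod 1 = 1" using l by simp_all
  note onbs = faut_onb[OF g oE_onb(1)] faut_onb[OF g oE_onb(2)] faut_onb[OF g oE_onb(3)]
  note mult = faut_omul[OF g, symmetric] oE_omul lc
  have u: "g (oE1 z) \<in> Pu F Oset \<and> g (oE1 z) \<bullet> g (oE1 z) = 1" "g (oE2 z) \<in> Pu F Oset \<and> g (oE2 z) \<bullet> g (oE2 z) = 1"
    "g (oE3 z) \<in> Pu F Oset \<and> g (oE3 z) \<bullet> g (oE3 z) = 1" if "cmod z = 1" for z
    using that oE_norm oE_Pu g by (simp_all add: faut_inner faut_Pu)
  have "loops_agree x y (g (oE1 l), g (oE1 1)) (g (oE2 (cnj l)), g (oE2 1))"
    by (rule loops_agree_swap[OF x]) (use l c onbs in \<open>simp_all add: mult\<close>)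
  moreover have "loops_agree x y (g (oE2 (cnj l)), g (oE2 1)) (g (oE3 l), g (oE3 1))"
    by (rule loops_agree_swap[OF x]) (use l c onbs in \<open>simp_all add: mult\<close>)
  moreover have "loops_agree x y (g (oE3 l), g (oE3 1)) (g (oE1 (cnj l)), g (oE1 1))"
    by (rule loops_agree_swap[OF x]) (use l c onbs in \<open>simp_all add: mult\<close>)
  ultimately have agree: "loops_agree x y (g (oE1 l), g (oE1 1)) (g (oE1 (cnj l)), g (oE1 1))"
    by (meson loops_agree_trans[OF x] u(2)[OF c(1)] u(2)[OF c(2)] u(3)[OF l] u(3)[OF c(2)])
  \<comment> \<open>The second components of the two pairs coincide, so one plane \<open>b\<close>
    closes both loops and can be cancelled.\<close>
  obtain b where b: "sharp F A pr b" "b x = g (oE1 1)"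
    using plane_through[OF x] u(1)[OF c(2)] by metis
  have "loop_at (omul x y) y s b \<simeq> loop_at (omul x y) y t b"
    using agree s t b unfolding loops_agree_def by simp
  moreover have "onb A y (omul x y)" using onb_omul[OF x] by simp
  then have "pt (omul x y) \<in> Gpoints" "pt y \<in> Gpoints"
    using onb_Pu onb_nonzero point_mem by blast+
  ultimately show ?thesis
    using loop_cancel s t b plane_mem by blast
qed

text \<open>With \<open>n = ofC \<i>\<close> the automorphism fixes all of \<open>Cset\<close>, so
  it is complex linear on coordinates even when \<open>F = Rset\<close>.\<close>

lemma complex_linear_faut:
  assumes "basic_triple (ofC \<i>) a b"
  obtains g where "faut g" "\<And>z. g (oE1 z) = omul a (ofC z)" "\<And>z. g (oE2 z) = omul b (ofC z)"
proof
  let ?g = "omap (ofC \<i>) a b"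
  show g: "faut ?g"
    unfolding faut_def using omap_oaut[OF assms] omap_fixes_ofC[OF assms] F_cases_ofC by metis
  show "?g (oE1 z) = omul a (ofC z)" "?g (oE2 z) = omul b (ofC z)" for z
    using faut_omul[OF g, of "oE1 1" "ofC z"] faut_omul[OF g, of "oE2 1" "ofC z"]
    by (simp_all add: oE_ofC omap_values omap_fixes_ofC[OF assms])
qed

text \<open>For a square root \<open>l\<close> of \<open>k\<close>, the diagonal automorphism
  \<open>d\<close> with phases \<open>l\<close>, \<open>cnj l\<close>, 1 carries the conjugate
  phases \<open>l\<close> and \<open>cnj l\<close> in the first coordinate to \<open>k\<close> and
  1, which reduces the claim to \<open>square_conjugate_phases\<close>.\<close>

lemma square_phase:
  assumes x: "onb A x y" and g: "faut g" and k: "cmod k = 1"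
    and s: "sharp F A pr s" "s x = g (oE1 k)" and t: "sharp F A pr t" "t x = g (oE1 1)"
  shows "square (omul x y) y s t"
proof -
  define l where "l = csqrt k"
  have l: "cmod l = 1" "l * l = k" "l * cnj l = 1"
    using k by (simp_all add: l_def power2_eq_square[symmetric] complex_norm_square[symmetric])
  have "(Re l)\<^sup>2 + (Im l)\<^sup>2 = 1" using l(1) by (simp add: cmod_def)
  then have "basic_triple (ofC \<i>) (oE1 l) (oE2 (cnj l))"
    by (simp add: basic_triple_def oE_defs ofC_def oone_def inner_prod_def inner_complex_def oct_unfold power2_eq_square)
  then obtain d where d: "faut d" "\<And>z. d (oE1 z) = oE1 (l * z)"
    using complex_linear_faut[of "oE1 l" "oE2 (cnj l)"] by (metis oE_ofC(1))
  show ?thesis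
    by (rule square_conjugate_phases[OF x faut_comp[OF g d(1)] l(1) s(1) _ t(1)]) (use s t d l in simp_all)
qed

text \<open>The squares of \<open>x\<close> and \<open>y\<close> are both \<open>- oone\<close> and
  cancel, while the mixed terms add up since \<open>yx = - xy\<close>; thus the rotated frame keeps
  its third vector.\<close>

lemma onb_rotate:
  assumes x: "onb B x y" and B: "B = A \<or> B = Oset"
  defines "h \<equiv> 1 / sqrt 2"
  shows "onb B (h *\<^sub>R (x - y)) (h *\<^sub>R (x + y))" "onb B (h *\<^sub>R (x + y)) (h *\<^sub>R (x - y))"
    "omul (h *\<^sub>R (x - y)) (h *\<^sub>R (x + y)) = omul x y"
proof -
  have h: "h * h = 1/2" by (simp add: h_def)
  have xy: "x \<bullet> x = 1" "y \<bullet> y = 1" "x \<bullet> y = 0" "y \<bullet> x = 0"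
    using x pr_imp_orthogonal by (auto simp: onb_def inner_commute)
  have "x - y \<in> Pu F B" "x + y \<in> Pu F B"
    using x B Pu_add Pu_diff unfolding onb_def by blast+
  then have Pu: "h *\<^sub>R (x - y) \<in> Pu F B" "h *\<^sub>R (x + y) \<in> Pu F B"
    using B Pu_scaleR by blast+
  have n: "h * (h * (2::real)) = 1" using h by simp
  show 1: "onb B (h *\<^sub>R (x + y)) (h *\<^sub>R (x - y))"
    unfolding onb_def using Pu pr_scaleR[OF onb_pr_sum_diff[OF x]] n by (simp add: inner_simps xy)
  then show "onb B (h *\<^sub>R (x - y)) (h *\<^sub>R (x + y))" by (rule onb_sym)
  have sq: "omul z z = - oone" if "z \<bullet> oone = 0" "z \<bullet> z = 1" for z
    using left_alternative[of z oone] that by (metis imaginary_cnj minus_minus omul_minus_left omul_oone(2) scaleR_one)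
  have "x \<bullet> oone = 0" "y \<bullet> oone = 0"
    using x oone_in_F by (auto simp: onb_def Pu_iff inner_commute)
  then have "omul (x - y) (x + y) = 2 *\<^sub>R omul x y"
    using onb_omul(5)[OF x B] sq xy by (simp add: omul_distribs scaleR_2)
  then show "omul (h *\<^sub>R (x - y)) (h *\<^sub>R (x + y)) = omul x y"
    using n by simp
qed

text \<open>In the rotated frame \<open>p, w\<close> the planes \<open>a\<close> and \<open>a'\<close> of the proof differ by a phase at \<open>p\<close> and agree
  at \<open>pw = xy\<close>.\<close>

lemma square_orthogonal:
  assumes x: "onb A x y" and u: "onb Oset u u'"
    and s: "sharp F A pr s" "s x = u" and t: "sharp F A pr t" "t x = u'"
  shows "square (omul x y) y s t"
proof -
  define h :: real where "h = 1 / sqrt 2"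
  have h: "h * h = 1/2" by (simp add: h_def)
  define r p w where "r = omul x y" and "p = h *\<^sub>R (x - y)" and "w = h *\<^sub>R (x + y)"
  have pw: "onb A p w" "omul p w = r"
    using onb_rotate[OF x] by (simp_all add: p_def w_def h_def r_def)
  have half: "h *\<^sub>R h *\<^sub>R z + h *\<^sub>R h *\<^sub>R z = z" for z :: oct
    by (simp add: h scaleR_add_left[symmetric] del: scaleR_add_left)
  have xpw: "x = h *\<^sub>R p + h *\<^sub>R w"
    using half[of x] by (simp add: p_def w_def algebra_simps)
  \<comment> \<open>In the coordinates given by \<open>g\<close> the vectors \<open>u\<close> and
    \<open>u'\<close> are the normalised sum and difference of the first two basis vectors.\<close>
  obtain g where g: "faut g" "g (oE1 1) = h *\<^sub>R (u + u')" "g (oE2 1) = h *\<^sub>R (u - u')"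
    using faut_exists[OF onb_rotate(2)[OF u]] h_def by auto
  have gu: "h *\<^sub>R g (oE1 1) + h *\<^sub>R g (oE2 1) = u" "h *\<^sub>R g (oE1 1) - h *\<^sub>R g (oE2 1) = u'"
    using half[of u] half[of u'] by (simp_all add: g algebra_simps)
  have i: "cmod \<i> = 1" "cmod (- \<i>) = 1" by simp_all
  obtain a where a: "sharp F A pr a" "a p = g (oE1 1)" "a r = g (oE3 1)" "a x = u"
  proof -
    have "omul (g (oE1 1)) (g (oE2 1)) = g (oE3 1)" by (simp add: faut_omul[OF g(1), symmetric] oE_omul)
    then show thesis
      using plane_exists[OF pw(1) faut_onb[OF g(1) oE_onb(1)], of 1 1] that pw(2) xpw gu(1) by (metis norm_one)
  qed
  \<comment> \<open>The phases \<open>\<i>\<close> and \<open>- \<i>\<close> cancel in the product,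
    so \<open>a'\<close> agrees with \<open>a\<close> at \<open>r\<close>; at \<open>x\<close> the
    sum becomes a difference, namely \<open>u'\<close> with its \<open>g\<close>-coordinates
    multiplied by \<open>\<i>\<close>.\<close>
  obtain a' where a': "sharp F A pr a'" "a' p = g (oE1 \<i>)" "a' r = g (oE3 1)"
    "a' x = h *\<^sub>R g (oE1 \<i>) + h *\<^sub>R g (oE2 (- \<i>))"
  proof -
    have "omul (g (oE1 \<i>)) (g (oE2 (- \<i>))) = g (oE3 1)" by (simp add: faut_omul[OF g(1), symmetric] oE_omul)
    then show thesis
      using plane_exists[OF pw(1) faut_onb[OF g(1) oE_onb(1)], of \<i> "- \<i>"] that pw(2) xpw i by metis
  qed
  have onb: "onb A y r" "onb A r x" using onb_omul[OF x] by (simp_all add: r_def)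
  have onb': "onb A w r" "onb A r p" using onb_omul[OF pw(1)] pw(2) by simp_all
  have Pu: "x \<in> Pu F A" "y \<in> Pu F A" "r \<in> Pu F A" "w \<in> Pu F A" "x \<noteq> 0" "y \<noteq> 0" "r \<noteq> 0" "w \<noteq> 0"
    using onb_Pu onb_nonzero x onb onb' by blast+
  have pr: "pr x y = ozero" "pr x r = ozero" "pr r y = ozero" "pr r w = ozero"
    using onb_pr pr_sym x onb onb' by blast+
  have pts: "pt r \<in> Gpoints" "pt y \<in> Gpoints" "pt w \<in> Gpoints" using Pu point_mem by blast+
  have pls: "Pl a \<in> Gplanes" "Pl a' \<in> Gplanes" using a a' plane_mem by blast+
  have "square r w a' a"
    using square_phase[OF pw(1) g(1), of \<i> a' a] a a' pw(2) by simp
  then have "loop_at r w a' a \<simeq> [pt r]" using loop_null_iff pts pls by blast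
  moreover have "loop_at r y a' a \<simeq> loop_at r w a' a"
    by (rule loop_at_swap[where z=r]) (use a a' Pu pr in auto)
  ultimately have 2: "square r y a' a" using loop_null_iff pts pls htp_trans by blast
  have 1: "square r y s a"
    by (rule square_null(1)[where z=x]) (use a s Pu pr in auto)
  \<comment> \<open>The rotation \<open>d\<close> makes \<open>u'\<close> a first basis vector, so
    \<open>a'\<close> and \<open>t\<close> differ at \<open>x\<close> only by the phase
    \<open>\<i>\<close>.\<close>
  have 3: "square r y a' t"
  proof -
    have "basic_triple (ofC \<i>) (h *\<^sub>R (oE1 1 - oE2 1)) (h *\<^sub>R (oE1 1 + oE2 1))"
      using h by (simp add: basic_triple_def oE_defs ofC_def oone_def inner_prod_def inner_complex_def oct_unfold)
    then obtain d where d: "faut d" and d1: "\<And>z. d (oE1 z) = omul (h *\<^sub>R (oE1 1 - oE2 1)) (ofC z)"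
      by (rule complex_linear_faut) blast
    have dE: "d (oE1 z) = h *\<^sub>R (oE1 z - oE2 z)" for z
      by (simp add: d1 omul_diff_left oE_ofC)
    have "oE2 (- \<i>) = - oE2 \<i>" by (simp add: oE_defs)
    then have "a' x = (g \<circ> d) (oE1 \<i>)" "t x = (g \<circ> d) (oE1 1)"
      using a' t gu g(1) by (simp_all add: dE faut_scaleR faut_diff faut_minus scaleR_diff_right)
    then show ?thesis
      using square_phase[OF x faut_comp[OF g(1) d], of \<i> a' t] a' t i by (simp add: r_def)
  qed
  show ?thesis
    using 1 2 3 htp_sym htp_trans unfolding r_def by blast
qed

lemma square_frame:
  assumes x: "onb A x y" and s: "sharp F A pr s" and t: "sharp F A pr t"
  shows "square (omul x y) y s t"
proof -
  have xA: "x \<in> Pu F A" "x \<in> A" "x \<bullet> x = 1" using x by (auto simp: onb_def Pu_iff)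
  obtain v where v: "v \<in> Pu F Oset" "v \<bullet> v = 1" "pr (s x) v = ozero" "pr (t x) v = ozero"
    using perpendicular_exists[of Oset "s x" "t x"] by blast
  have on: "onb Oset (s x) v" "onb Oset v (t x)"
    using v xA sharp_Pu sharp_inner s t by (auto simp: onb_def intro: pr_sym)
  obtain b where b: "sharp F A pr b" "b x = v"
    by (rule plane_through[OF x v(1,2)])
  have "square (omul x y) y s b"
    by (rule square_orthogonal[OF x on(1) s refl b])
  also have "square (omul x y) y b t"
    by (rule square_orthogonal[OF x on(2) b t refl])
  finally show ?thesis .
qed

text \<open>Arbitrary points \<open>P\<close> and \<open>Q\<close> are joined through a point
  \<open>r\<close> orthogonal to both, and the square is split at \<open>r\<close>.\<close>

lemma square_all:
  assumes "P \<in> Gpoints" "Q \<in> Gpoints" "S \<in> Gplanes" "T \<in> Gplanes"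
  shows "[P,S,Q] \<simeq> [P,T,Q]"
proof -
  have unit: "\<exists>x. P = pt x \<and> x \<in> Pu F A \<and> x \<bullet> x = 1" if "P \<in> Gpoints" for P
  proof -
    obtain x where x: "P = pt x" "x \<in> Pu F A" "x \<noteq> 0" using \<open>P \<in> Gpoints\<close> unfolding Gpoints_def by blast
    have "P = pt ((1 / norm x) *\<^sub>R x)" using x opoint_scaleR[of "1 / norm x" x] by simp
    then show ?thesis using Pu_scaleR(1)[OF x(2)] unit_scaleR[OF x(3)] by blast
  qed
  obtain x y where xy: "P = pt x" "x \<in> Pu F A" "x \<bullet> x = 1" "Q = pt y" "y \<in> Pu F A" "y \<bullet> y = 1"
    using unit assms by metis
  obtain s t where st: "S = Pl s" "sharp F A pr s" "T = Pl t" "sharp F A pr t"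
    using assms unfolding Gplanes_def by blast
  obtain r where r: "r \<in> Pu F A" "r \<bullet> r = 1" "pr x r = ozero" "pr y r = ozero"
    using perpendicular_exists[of A x y] by blast
  have "pt r \<in> Gpoints" using r point_mem unit_nonzero by blast
  \<comment> \<open>In the cyclically shifted frame starting with \<open>yx\<close> and
    \<open>y\<close> the third vector \<open>(yx)y\<close> is \<open>x\<close>.\<close>
  have frame: "square x y s t" if "onb A y x" for x y
    using square_frame[of "omul y x" y s t] onb_omul[OF that] st by simp
  have "onb A r x" "onb A y r"
    using xy r by (auto simp: onb_def intro: pr_sym)
  then have "square x r s t" "square r y s t" using frame by blast+
  then show ?thesis
    using square_trans_point \<open>pt r \<in> Gpoints\<close> assms xy st by blast
qed

lemma simply_connected_geometry: "simply_connected GV GI"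
proof -
  obtain r where "r \<in> Pu F A" "r \<bullet> r = 1"
    using perpendicular_exists[of A 0 0] by blast
  then have "pt r \<in> Gpoints" using point_mem unit_nonzero by blast
  moreover have "faut id" by (simp add: faut_def oaut_def linear_id[unfolded id_def] id_def)
  then have "Pl (plane id) \<in> Gplanes" using sharp_plane plane_mem by blast
  ultimately show ?thesis
    using simply_connectedI[OF square_all] by blast
qed

end

theorem theorem1p5:
  shows "simply_connected (Gelems Rset Hset pairR) (Gincid Rset pairR)
       \<and> simply_connected (Gelems Cset Oset pairC) (Gincid Cset pairC)"
proof -
  interpret R: scalars Rset Hset pairR by unfold_locales simp
  interpret C: scalars Cset Oset pairC by unfold_locales simp
  show ?thesis using R.simply_connected_geometry C.simply_connected_geometry by blast
qed

end
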